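(* Let assumptions $\mathrm{Asm}_1$–$\mathrm{Asm}_4$ (stated in the context) hold for the depth function $D$ and the distribution $P$, with a common exponent $\beta\in(1/2,1]$, let $P=Q$ (null hypothesis), and let $m,n\to\infty$ with $\frac{m}{m+n}\to\tau$ for some $0<\tau<1$. Then $$\mathcal{LS}(\widehat P_m,\widehat Q_n)+\mathcal{LS}(\widehat Q_n,\widehat P_m)-1=O_P(\delta_{m,n}),$$ where $$\delta_{m,n}=\begin{cases}\left(\frac{m+n}{mn}\right)^{\beta}&\text{for }\frac12<\beta\le\frac23,\\[2pt]\left(\frac{m+n}{mn}\right)^{\frac{2+\beta}{4}}&\text{for }\frac23\le\beta\le1.\end{cases}$$ In particular, in the Lipschitz case $\beta=1$ the rate $\delta_{m,n}=\left(\frac{m+n}{mn}\right)^{3/4}$ is achieved.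
   Context: $\Omega$ is a measurable space, $\mathcal P_\Omega$ the collection of probability measures on it, and $D:\Omega\times\mathcal P_\Omega\to\mathbb R_{\ge0}$ a depth function. $X,X_1,\dots,X_m$ are i.i.d. with distribution $P$, independent of $Y,Y_1,\dots,Y_n$ i.i.d. with distribution $Q$, all with values in $\Omega$. $\widehat P_m$ and $\widehat Q_n$ are the empirical measures of $X_1,\dots,X_m$ and $Y_1,\dots,Y_n$. For an index set $I$, $\widehat P_m^{-I}$ is the empirical measure of $\{X_i: i\in\{1,\dots,m\}\setminus I\}$. The $\mathcal{LS}$-statistic is $$\mathcal{LS}(\widehat P_m,\widehat Q_n)=\frac1{mn}\sum_{i=1}^m\sum_{j=1}^n\left(\mathbb 1_{\{D(X_i,\widehat P_m)<D(Y_j,\widehat P_m)\}}+\tfrac12\mathbb 1_{\{D(X_i,\widehat P_m)=D(Y_j,\widehat P_m)\}}\right),$$ and $\mathcal{LS}(\widehat Q_n,\widehat P_m)$ is obtained by exchanging the roles of the two samples (depths computed with respect to $\widehat Q_n$). Assumptions, for some $1/2<\beta\le1$: $\mathrm{Asm}_1$: there is $C>0$ with $\mathbb P(D(X,P)\in[y_1,y_2])\le C|y_2-y_1|^\beta$ for all $y_1,y_2\in\mathbb R_{\ge0}$. $\mathrm{Asm}_2$: $\mathbb E\big(\sup_{x\in\Omega}|D(x,\widehat P_m)-D(x,P)|^{2\beta}\big)=O(m^{-\beta})$. $\mathrm{Asm}_3$: there exist a deterministic constant $C_{\det}$ and an index $m_0$ such that for every $m\ge m_0$, $\sup_{x\in\Omega}|D(x,\widehat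 P_m)-D(x,\widehat P_m^{-\{1\}})|\le C_{\det}/m$ almost surely. $\mathrm{Asm}_4$: with $X$ an independent copy of $X_1,\dots,X_m$, for any constant $C>0$, $\mathbb E\Big(\big[\mathbb P\big(|D(X_1,\widehat P_m^{-\{1\}})-D(X,\widehat P_m^{-\{1\}})|\le \tfrac Cm\,\big|\,X_2,\dots,X_m\big)\big]^2\Big)=O(m^{-2\beta})$. $Z_{m,n}=O_P(\delta_{m,n})$ means $Z_{m,n}/\delta_{m,n}$ is stochastically bounded. *)

theory Defs
  imports "HOL-Probability.Probability"
begin

text \<open>
  Throughout, \<open>S\<close> is the measurable space $\Omega$; the probability measures on it are the elements
  of \<open>space (prob_algebra S)\<close>.  A sample is a function \<open>x :: nat \<Rightarrow> 'a\<close>; its observations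
  are numbered from 1, and index 0 holds the additional independent copy.
\<close>

definition emp :: "'a measure \<Rightarrow> nat set \<Rightarrow> (nat \<Rightarrow> 'a) \<Rightarrow> 'a measure" where
  "emp S I x = distr (uniform_count_measure I) S x"

text \<open>
  The two measurability clauses are what makes the probabilities and expectations of
  \<open>D(X, P)\<close> and \<open>D(X, P\<^sub>m)\<close> in the assumptions and in the statistic meaningful.
  Both follow from joint measurability of \<open>D\<close> on \<open>S \<Otimes>\<^sub>M prob_algebra S\<close>.
\<close>
definition depth_function :: "'a measure \<Rightarrow> ('a \<Rightarrow> 'a measure \<Rightarrow> real) \<Rightarrow> bool" where
  "depth_function S D \<longleftrightarrow>
     (\<forall>x\<in>space S. \<forall>\<mu>\<in>space (prob_algebra S). 0 \<le> D x \<mu>) \<and>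
     (\<forall>\<mu>\<in>space (prob_algebra S). (\<lambda>x. D x \<mu>) \<in> borel_measurable S) \<and>
     (\<forall>m\<ge>1. (\<lambda>(x, xs). D x (emp S {1..m} xs))
               \<in> borel_measurable (S \<Otimes>\<^sub>M PiM {1..m} (\<lambda>_. S)))"

definition LS :: "'a measure \<Rightarrow> ('a \<Rightarrow> 'a measure \<Rightarrow> real) \<Rightarrow>
    nat \<Rightarrow> (nat \<Rightarrow> 'a) \<Rightarrow> nat \<Rightarrow> (nat \<Rightarrow> 'a) \<Rightarrow> real" where
  "LS S D m x n y =
     1 / (real m * real n) *
       (\<Sum>i=1..m. \<Sum>j=1..n.
          of_bool (D (x i) (emp S {1..m} x) < D (y j) (emp S {1..m} x))
          + 1/2 * of_bool (D (x i) (emp S {1..m} x) = D (y j) (emp S {1..m} x)))"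

text \<open>
  The assumptions concern only \<open>D\<close> and \<open>P\<close>, so they are stated on the canonical space of an
  i.i.d. sequence with law \<open>P\<close>, whose coordinates 0, 1, 2, ... play the role of
  $X, X_1, X_2, \ldots$.
\<close>
definition iid :: "'a measure \<Rightarrow> (nat \<Rightarrow> 'a) measure" where
  "iid P = PiM UNIV (\<lambda>_. P)"

definition coord_algebra :: "'a measure \<Rightarrow> nat set \<Rightarrow> (nat \<Rightarrow> 'a) measure" where
  "coord_algebra P I = vimage_algebra (space (iid P)) (\<lambda>\<omega>. restrict \<omega> I) (PiM I (\<lambda>_. P))"

definition sup_dev :: "'a measure \<Rightarrow> ('a \<Rightarrow> 'a measure \<Rightarrow> real) \<Rightarrow>
    'a measure \<Rightarrow> 'a measure \<Rightarrow> ennreal" where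
  "sup_dev S D \<mu> \<nu> = (SUP x\<in>space S. ennreal \<bar>D x \<mu> - D x \<nu>\<bar>)"

definition ennreal_powr :: "ennreal \<Rightarrow> real \<Rightarrow> ennreal" where
  "ennreal_powr t p = (if t = \<top> then \<top> else ennreal (enn2real t powr p))"

text \<open>
  A supremum over an uncountable space need not be measurable, and on a nonmeasurable function
  the library's nonnegative integral is an inner integral.  The outer expectation below agrees
  with the integral on measurable functions.
\<close>
definition outer_expectation :: "'b measure \<Rightarrow> ('b \<Rightarrow> ennreal) \<Rightarrow> ennreal" where
  "outer_expectation M f =
     (INF g\<in>{g \<in> borel_measurable M. \<forall>\<omega>\<in>space M. f \<omega> \<le> g \<omega>}. \<integral>\<^sup>+ \<omega>. g \<omega> \<partial>M)"

lemma outer_expectation_measurable: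
  assumes "f \<in> borel_measurable M"
  shows "outer_expectation M f = (\<integral>\<^sup>+ \<omega>. f \<omega> \<partial>M)"
  unfolding outer_expectation_def
  using assms by (intro antisym INF_lower INF_greatest nn_integral_mono) auto

definition Asm1 :: "('a \<Rightarrow> 'a measure \<Rightarrow> real) \<Rightarrow> 'a measure \<Rightarrow> real \<Rightarrow> bool" where
  "Asm1 D P \<beta> \<longleftrightarrow>
     (\<exists>C>0. \<forall>y1\<ge>0. \<forall>y2\<ge>0.
        measure P {x \<in> space P. D x P \<in> {y1..y2}} \<le> C * \<bar>y2 - y1\<bar> powr \<beta>)"

definition Asm2 :: "'a measure \<Rightarrow> ('a \<Rightarrow> 'a measure \<Rightarrow> real) \<Rightarrow> 'a measure \<Rightarrow> real \<Rightarrow> bool" where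
  "Asm2 S D P \<beta> \<longleftrightarrow>
     (\<exists>C::real. \<forall>\<^sub>F m in sequentially.
        outer_expectation (iid P) (\<lambda>\<omega>. ennreal_powr (sup_dev S D (emp S {1..m} \<omega>) P) (2 * \<beta>))
          \<le> ennreal (C * real m powr (- \<beta>)))"

definition Asm3 :: "'a measure \<Rightarrow> ('a \<Rightarrow> 'a measure \<Rightarrow> real) \<Rightarrow> 'a measure \<Rightarrow> bool" where
  "Asm3 S D P \<longleftrightarrow>
     (\<exists>(Cdet::real) m0. \<forall>m\<ge>m0. AE \<omega> in iid P.
        sup_dev S D (emp S {1..m} \<omega>) (emp S ({1..m} - {1}) \<omega>) \<le> ennreal (Cdet / real m))"

definition Asm4 :: "'a measure \<Rightarrow> ('a \<Rightarrow> 'a measure \<Rightarrow> real) \<Rightarrow> 'a measure \<Rightarrow> real \<Rightarrow> bool" where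
  "Asm4 S D P \<beta> \<longleftrightarrow>
     (\<forall>C>0. (\<lambda>m. \<integral>\<omega>. (real_cond_exp (iid P) (coord_algebra P {2..m})
                (indicator {\<omega> \<in> space (iid P).
                   \<bar>D (\<omega> 1) (emp S ({1..m} - {1}) \<omega>) - D (\<omega> 0) (emp S ({1..m} - {1}) \<omega>)\<bar>
                     \<le> C / real m}) \<omega>)\<^sup>2 \<partial>iid P)
            \<in> O(\<lambda>m. real m powr (- 2 * \<beta>)))"

definition rate :: "real \<Rightarrow> nat \<Rightarrow> nat \<Rightarrow> real" where
  "rate \<beta> m n =
     (if \<beta> \<le> 2/3 then (real (m + n) / real (m * n)) powr \<beta>
      else (real (m + n) / real (m * n)) powr ((2 + \<beta>) / 4))"

text \<open>
  \<open>big_OP M Z \<delta>\<close> is $Z_k = O_P(\delta_k)$ as $k \to \infty$.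
  Measurability is included because \<open>measure\<close> is 0 on nonmeasurable sets.
\<close>
definition big_OP :: "'b measure \<Rightarrow> (nat \<Rightarrow> 'b \<Rightarrow> real) \<Rightarrow> (nat \<Rightarrow> real) \<Rightarrow> bool" where
  "big_OP M Z \<delta> \<longleftrightarrow>
     (\<forall>k. Z k \<in> borel_measurable M) \<and>
     (\<forall>\<epsilon>>0. \<exists>K. \<forall>\<^sub>F k in sequentially.
        measure M {\<omega> \<in> space M. \<bar>Z k \<omega> / \<delta> k\<bar> > K} < \<epsilon>)"

end

theory Submission
  imports Defs
begin

text \<open>
  Up to the constants $1/2$, both statistics are averages of \<open>sgn (D(Y\<^sub>j) - D(X\<^sub>i))\<close>, and replacing the
  empirical depth by \<open>D(\<cdot>, P)\<close> turns their sum into \<open>0\<close>.  So it suffices to bound, for one sample,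
  the average of the errors made by this replacement.  By \<open>Asm3\<close> and \<open>Asm4\<close>, deleting \<open>X\<^sub>i\<close> from the
  empirical measure in the $(i,j)$ term costs $O(m^{-\beta})$ in mean.  After the deletion each term is
  antisymmetric in \<open>X\<^sub>i\<close>, \<open>Y\<^sub>j\<close> given the rest, so two terms with no common index are correlated only
  through the second deletion, which contributes $O(m^{-2\beta})$ to the second moment, again by \<open>Asm4\<close>.
  Two terms with a common index are bounded by the probability that a sign changes, which is
  $O(m^{-\beta/2})$ by \<open>Asm1\<close> and \<open>Asm2\<close>.  With $q = (m+n)/(mn)$ the mean error is therefore
  $O(q^\beta + q^{(1+\beta/2)/2})$, which is the stated rate.
\<close>

section \<open>Empirical measures and i.i.d. samples\<close>

text \<open>Deletion is forced by a self-reference: X_i enters the empirical measure by which it is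
  itself ranked, so exchanging X_i with Y_j changes that measure. Once X_i is removed, the exchange
  preserves the law and the measure and reverses the sign. The self-reference returns for two terms
  (i,j) and (i',j'): the measure of the first still contains X_i', that of the second X_i. Removing
  these too leaves a product of two perturbations, and given the remaining sample both are confined
  to conditionally independent events of equal probability; this is what the squared conditional
  probability in \<open>Asm4\<close> measures.

  The assumptions treat the sample 1, ..., m and the deletion of observation 1. Injective reindexing
  of one infinite i.i.d. sequence carries them to arbitrary index sets; the second sample occupies
  the coordinates after m.

  The exponent (2 + \<beta>) / 4 arises because about mn(m+n) of the (mn)^2 pairs of terms share an
  index, which gives a second moment of order q^(1 + \<beta>/2). It falls below \<beta> exactly when
  \<beta> > 2/3.\<close>

lemma emp_cong:
  assumes "\<And>i. i \<in> I \<Longrightarrow> x i = y i"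
  shows "emp S I x = emp S I y"
proof -
  have "x -` A \<inter> I = y -` A \<inter> I" for A
    using assms by auto
  then show ?thesis
    by (simp add: emp_def distr_def space_uniform_count_measure)
qed

lemma emp_fun_upd: "i \<notin> I \<Longrightarrow> emp S I (w(i := x)) = emp S I w"
  by (intro emp_cong) auto

lemma emp_reindex:
  assumes "inj_on f I" "finite I"
  shows "emp S (f ` I) x = emp S I (\<lambda>i. x (f i))"
proof -
  have eq: "x -` A \<inter> f ` I = f ` ((\<lambda>i. x (f i)) -` A \<inter> I)" for A
    by auto
  have "card (x -` A \<inter> f ` I) = card ((\<lambda>i. x (f i)) -` A \<inter> I)" for A
    unfolding eq by (rule card_image) (meson assms(1) inf_le2 inj_on_subset)
  then show ?thesis
    using assms
    by (simp add: emp_def distr_def space_uniform_count_measure emeasure_uniform_count_measure card_image)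
qed

text \<open>Extending a bijection to an injection of all indices makes it a law-preserving
  reindexing of the whole i.i.d. sequence. The point \<open>a\<close> takes the place of observation
  1, which is the one deleted in \<open>Asm3\<close> and \<open>Asm4\<close>; avoiding
  \<open>F\<close> keeps reindexed functions free of the coordinates in \<open>F\<close>.\<close>

lemma ex_inj_bij_betw:
  fixes I F :: "nat set"
  assumes I: "finite I" "card I = k" "a \<in> I" and F: "finite F" "F \<inter> I = {}"
  obtains \<sigma> where "inj \<sigma>" "\<sigma> ` {1..k} = I" "\<sigma> 1 = a" "range \<sigma> \<inter> F = {}"
proof -
  obtain f where f: "bij_betw f {1..k} I"
    using ex_bij_betw_nat_finite_1 I by metis
  have k: "1 \<in> {1..k}"
    using I by (metis One_nat_def atLeastAtMost_iff card_gt_0_iff empty_iff le_refl less_eq_Suc_le)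
  obtain c where c: "c \<in> {1..k}" "f c = a"
    using f \<open>a \<in> I\<close> by (metis bij_betw_def imageE)
  define g where "g = f \<circ> Transposition.transpose 1 c"
  have g: "bij_betw g {1..k} I"
    unfolding g_def
    by (rule bij_betw_trans[OF permutes_imp_bij[OF permutes_swap_id[OF k c(1)]] f])
  have g1: "g 1 = a"
    using c by (simp add: g_def)
  \<comment> \<open>All of \<open>I\<close> and \<open>F\<close> lies below \<open>N\<close>, so the
    indices outside {1..k}, including 0, can be shifted by \<open>N\<close> without
    collision.\<close>
  define N where "N = Suc (Max (insert 0 (I \<union> F)))"
  have N: "i < N" if "i \<in> I \<union> F" for i
    using that I F by (auto simp: N_def less_Suc_eq_le)
  have gN: "g i < N" if "i \<in> {1..k}" for i
    using N bij_betw_apply[OF g that] by blast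
  define \<sigma> where "\<sigma> i = (if i \<in> {1..k} then g i else N + i)" for i
  have "inj \<sigma>"
  proof (rule injI)
    fix i j assume eq: "\<sigma> i = \<sigma> j"
    consider "i \<in> {1..k}" "j \<in> {1..k}" | "i \<in> {1..k}" "j \<notin> {1..k}"
      | "i \<notin> {1..k}" "j \<in> {1..k}" | "i \<notin> {1..k}" "j \<notin> {1..k}"
      by blast
    then show "i = j"
    proof cases
      case 1
      then have "g i = g j"
        using eq by (simp only: \<sigma>_def if_True)
      then show ?thesis
        using inj_onD[OF bij_betw_imp_inj_on[OF g]] 1 by blast
    next
      case 2
      then have "g i = N + j"
        using eq by (simp only: \<sigma>_def if_True if_False)
      then show ?thesis
        using gN[OF 2(1)] by linarith
    next
      case 3
      then have "N + i = g j"
        using eq by (simp only: \<sigma>_def if_True if_False)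
      then show ?thesis
        using gN[OF 3(2)] by linarith
    next
      case 4
      then have "N + i = N + j"
        using eq by (simp only: \<sigma>_def if_False)
      then show ?thesis
        by linarith
    qed
  qed
  moreover have "\<sigma> ` {1..k} = I"
    using g by (simp add: \<sigma>_def bij_betw_def)
  moreover have "\<sigma> 1 = a"
    using k g1 by (simp add: \<sigma>_def)
  moreover have "range \<sigma> \<inter> F = {}"
  proof -
    have "\<sigma> i \<notin> F" for i
    proof (cases "i \<in> {1..k}")
      case True
      then have "\<sigma> i \<in> I"
        using bij_betw_apply[OF g] by (simp add: \<sigma>_def)
      then show ?thesis
        using F(2) by blast
    next
      case False
      then have "\<sigma> i = N + i"
        by (simp only: \<sigma>_def if_False)
      then show ?thesis
        using N[of "\<sigma> i"] by auto
    qed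
    then show ?thesis
      by blast
  qed
  ultimately show ?thesis
    using that by blast
qed

text \<open>If \<bar>t\<bar> > r, a move by at most r cannot reach 0, so the sign stays; otherwise
  it changes by at most 2. Ties t = 0 lie in the band.\<close>

lemma abs_sgn_diff_le:
  fixes s t r :: real
  assumes "\<bar>s - t\<bar> \<le> r"
  shows "\<bar>sgn s - sgn t\<bar> \<le> 2 * of_bool (\<bar>t\<bar> \<le> r)"
  using assms by (auto simp: sgn_if)

text \<open>Here m - 1 \<ge> m / 2, so deleting one observation costs only a constant factor in a
  power rate.\<close>

lemma powr_minus_pred_le:
  fixes m :: nat
  assumes "2 \<le> m" "0 \<le> p"
  shows "real (m - 1) powr (- p) \<le> 2 powr p * real m powr (- p)"
proof -
  have "real (m - 1) powr (- p) \<le> (real m / 2) powr (- p)"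
    by (rule powr_mono2') (use assms in auto)
  also have "\<dots> = 2 powr p * real m powr (- p)"
    using assms by (simp add: powr_divide powr_minus field_simps)
  finally show ?thesis .
qed

locale iid_depth =
  fixes S P :: "'a measure" and D :: "'a \<Rightarrow> 'a measure \<Rightarrow> real"
  assumes depth: "depth_function S D" and P_prob: "P \<in> space (prob_algebra S)"
begin

sublocale P: prob_space P
  using P_prob by (simp add: space_prob_algebra)

lemma sets_P [simp, measurable_cong]: "sets P = sets S"
  using P_prob by (simp add: space_prob_algebra)

lemma space_P [simp]: "space P = space S"
  by (rule sets_eq_imp_space_eq) simp

sublocale iid: prob_space "iid P"
  unfolding iid_def by (rule prob_space_PiM) (rule P.prob_space_axioms)

lemma sets_iid [measurable_cong]: "sets (iid P) = sets (PiM UNIV (\<lambda>_. S))"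
  unfolding iid_def by (intro sets_PiM_cong) auto

lemma space_iid: "space (iid P) = UNIV \<rightarrow> space S"
  using sets_eq_imp_space_eq[OF sets_iid] by (auto simp: space_PiM PiE_def)

lemma depth_P_measurable [measurable]: "(\<lambda>x. D x P) \<in> borel_measurable S"
  using depth P_prob by (auto simp: depth_function_def)

text \<open>\<open>depth_function\<close> grants joint measurability for the index sets {1..m} only;
  a bijection from {1..card I} carries it to any finite nonempty \<open>I\<close>.\<close>

lemma depth_emp_measurable:
  assumes f [measurable]: "f \<in> R \<rightarrow>\<^sub>M S" and g [measurable]: "g \<in> R \<rightarrow>\<^sub>M PiM J (\<lambda>_. S)"
    and I: "finite I" "I \<noteq> {}" "I \<subseteq> J"
  shows "(\<lambda>w. D (f w) (emp S I (g w))) \<in> borel_measurable R"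
proof -
  obtain h where h: "bij_betw h {1..card I} I"
    using ex_bij_betw_nat_finite_1 I(1) by blast
  have [measurable]: "(\<lambda>(x, xs). D x (emp S {1..card I} xs))
      \<in> borel_measurable (S \<Otimes>\<^sub>M PiM {1..card I} (\<lambda>_. S))"
    using depth I by (simp add: depth_function_def Suc_leI card_gt_0_iff)
  have [measurable]: "(\<lambda>w. \<lambda>k\<in>{1..card I}. g w (h k)) \<in> R \<rightarrow>\<^sub>M PiM {1..card I} (\<lambda>_. S)"
  proof (rule measurable_restrict)
    fix k assume "k \<in> {1..card I}"
    then have "h k \<in> J"
      using h I(3) by (auto simp: bij_betw_def)
    then show "(\<lambda>w. g w (h k)) \<in> R \<rightarrow>\<^sub>M S"
      using measurable_compose[OF g measurable_component_singleton] by blast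
  qed
  have eq: "emp S I (g w) = emp S {1..card I} (\<lambda>k\<in>{1..card I}. g w (h k))" for w
  proof -
    have "emp S I (g w) = emp S {1..card I} (\<lambda>k. g w (h k))"
      using h emp_reindex[of h "{1..card I}" S "g w"] by (simp add: bij_betw_def)
    also have "\<dots> = emp S {1..card I} (\<lambda>k\<in>{1..card I}. g w (h k))"
      by (intro emp_cong) simp
    finally show ?thesis .
  qed
  have "(\<lambda>w. (\<lambda>(x, xs). D x (emp S {1..card I} xs)) (f w, \<lambda>k\<in>{1..card I}. g w (h k)))
      \<in> borel_measurable R"
    by measurable
  then show ?thesis
    by (simp add: eq)
qed

lemma measurable_iid_component [measurable]: "(\<lambda>w. w i) \<in> iid P \<rightarrow>\<^sub>M S"
  by measurable

lemma depth_emp_iid_measurable: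
  assumes "finite I" "I \<noteq> {}"
  shows "(\<lambda>w. D (w a) (emp S I w)) \<in> borel_measurable (iid P)"
  by (rule depth_emp_measurable[where J = UNIV]) (use assms in \<open>auto simp: measurable_ident_sets sets_iid\<close>)

section \<open>Invariance of the i.i.d. law under reindexing and resampling of coordinates\<close>

lemma distr_iid_reindex:
  assumes "inj \<sigma>"
  shows "distr (iid P) (iid P) (\<lambda>w i. w (\<sigma> i)) = iid P"
  using distr_PiM_reindex[of UNIV "\<lambda>_. P" \<sigma> UNIV] assms P.prob_space_axioms
  by (simp add: iid_def restrict_UNIV)

lemma reindex_measurable: "(\<lambda>w i. w (\<sigma> i)) \<in> iid P \<rightarrow>\<^sub>M iid P"
  unfolding iid_def by (rule measurable_PiM_single') (auto simp: space_PiM)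

lemma integral_reindex:
  fixes f :: "(nat \<Rightarrow> 'a) \<Rightarrow> real"
  assumes "inj \<sigma>" "f \<in> borel_measurable (iid P)"
  shows "(\<integral>w. f (\<lambda>i. w (\<sigma> i)) \<partial>iid P) = (\<integral>w. f w \<partial>iid P)"
proof -
  have "(\<integral>w. f w \<partial>iid P) = (\<integral>w. f w \<partial>distr (iid P) (iid P) (\<lambda>w i. w (\<sigma> i)))"
    by (simp only: distr_iid_reindex[OF assms(1)])
  also have "\<dots> = (\<integral>w. f (\<lambda>i. w (\<sigma> i)) \<partial>iid P)"
    by (rule integral_distr[OF reindex_measurable assms(2)])
  finally show ?thesis
    by (rule sym)
qed

lemma AE_reindex:
  assumes "inj \<sigma>" "AE w in iid P. Q w"
  shows "AE w in iid P. Q (\<lambda>i. w (\<sigma> i))"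
proof -
  have "AE w in distr (iid P) (iid P) (\<lambda>w i. w (\<sigma> i)). Q w"
    unfolding distr_iid_reindex[OF assms(1)] by (rule assms(2))
  then show ?thesis
    by (rule AE_distrD[OF reindex_measurable])
qed

lemma fun_upd_iid_measurable: "(\<lambda>(x, w). w(i := x)) \<in> P \<Otimes>\<^sub>M iid P \<rightarrow>\<^sub>M iid P"
  unfolding iid_def case_prod_beta by (rule measurable_fun_upd[where J = UNIV]) auto

text \<open>Overwriting coordinate \<open>i\<close> by an independent draw preserves the law. Fubini
  can thus integrate out one coordinate while the sample space remains the full sequence
  space.\<close>

lemma integral_fun_upd:
  fixes f :: "(nat \<Rightarrow> 'a) \<Rightarrow> real"
  assumes [measurable]: "f \<in> borel_measurable (iid P)"
    and B: "\<And>w. w \<in> space (iid P) \<Longrightarrow> \<bar>f w\<bar> \<le> B"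
  shows "(\<integral>w. f w \<partial>iid P) = (\<integral>w. \<integral>x. f (w(i := x)) \<partial>P \<partial>iid P)"
proof -
  interpret PN: pair_prob_space P "iid P" ..
  define u where "u = (\<lambda>(x, w). w(i := x) :: nat \<Rightarrow> 'a)"
  have u: "u \<in> P \<Otimes>\<^sub>M iid P \<rightarrow>\<^sub>M iid P"
    unfolding u_def by (rule fun_upd_iid_measurable)
  have distr_u: "distr (P \<Otimes>\<^sub>M iid P) (iid P) u = iid P"
    using distr_pair_PiM_eq_PiM[of UNIV "\<lambda>_. P" i] P.prob_space_axioms by (simp add: iid_def u_def)
  have int0: "integrable (P \<Otimes>\<^sub>M iid P) (\<lambda>z. f (u z))"
  proof (rule PN.P.integrable_const_bound[where B = B])
    show "AE z in P \<Otimes>\<^sub>M iid P. norm (f (u z)) \<le> B"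
      using B measurable_space[OF u] by (intro AE_I2) simp
    show "(\<lambda>z. f (u z)) \<in> borel_measurable (P \<Otimes>\<^sub>M iid P)"
      by (rule measurable_compose[OF u assms(1)])
  qed
  have eq: "case_prod (\<lambda>x w. f (u (x, w))) = (\<lambda>z. f (u z))"
    by (rule ext) (simp add: split_paired_all)
  have int: "integrable (P \<Otimes>\<^sub>M iid P) (case_prod (\<lambda>x w. f (u (x, w))))"
    unfolding eq by (rule int0)
  have "(\<integral>w. f w \<partial>iid P) = (\<integral>w. f w \<partial>distr (P \<Otimes>\<^sub>M iid P) (iid P) u)"
    by (simp only: distr_u)
  also have "\<dots> = (\<integral>z. f (u z) \<partial>(P \<Otimes>\<^sub>M iid P))"
    by (rule integral_distr[OF u assms(1)])
  also have "\<dots> = (\<integral>z. case_prod (\<lambda>x w. f (u (x, w))) z \<partial>(P \<Otimes>\<^sub>M iid P))"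
    by (simp only: eq)
  also have "\<dots> = (\<integral>w. \<integral>x. f (u (x, w)) \<partial>P \<partial>iid P)"
    by (rule PN.integral_snd[OF int, symmetric])
  also have "\<dots> = (\<integral>w. \<integral>x. f (w(i := x)) \<partial>P \<partial>iid P)"
    by (simp add: u_def)
  finally show ?thesis .
qed


lemma integral_abs_le:
  fixes f :: "'a \<Rightarrow> real"
  assumes [measurable]: "f \<in> borel_measurable P" and B: "\<And>x. x \<in> space S \<Longrightarrow> \<bar>f x\<bar> \<le> B"
  shows "\<bar>\<integral>x. f x \<partial>P\<bar> \<le> B"
proof -
  have "integrable P f"
    by (rule P.integrable_const_bound[where B = B]) (auto intro!: AE_I2 B)
  then have "(\<integral>x. \<bar>f x\<bar> \<partial>P) \<le> B"
    by (intro P.integral_le_const) (auto intro!: AE_I2 B)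
  then show ?thesis
    using integral_abs_bound[of P f] by linarith
qed

section \<open>Pairs of observations with close depths\<close>

definition close :: "nat set \<Rightarrow> real \<Rightarrow> nat \<Rightarrow> nat \<Rightarrow> (nat \<Rightarrow> 'a) \<Rightarrow> real" where
  "close I c a b w = of_bool (\<bar>D (w a) (emp S I w) - D (w b) (emp S I w)\<bar> \<le> c)"

text \<open>For \<open>a\<close>, \<open>b\<close> outside \<open>I\<close> this is the conditional
  probability of the event in \<open>close\<close> given the coordinates in \<open>I\<close>. As an
  explicit function of \<open>w\<close>, not an almost everywhere class, it can be reindexed
  pointwise.\<close>

definition close_prob :: "nat set \<Rightarrow> real \<Rightarrow> (nat \<Rightarrow> 'a) \<Rightarrow> real" where
  "close_prob I c w =
     (\<integral>y. \<integral>x. of_bool (\<bar>D x (emp S I w) - D y (emp S I w)\<bar> \<le> c) \<partial>P \<partial>P)"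

lemma close_measurable:
  assumes "finite I" "I \<noteq> {}"
  shows "close I c a b \<in> borel_measurable (iid P)"
proof -
  note [measurable] = depth_emp_iid_measurable[OF assms]
  have "close I c a b =
      (\<lambda>w. if \<bar>D (w a) (emp S I w) - D (w b) (emp S I w)\<bar> \<le> c then 1 else 0)"
    by (auto simp: close_def)
  then show ?thesis
    by simp
qed

text \<open>The free \<open>J\<close> serves two ends: \<open>J = UNIV\<close> gives measurability
  on the sequence space, \<open>J = I\<close> measurability with respect to the coordinates in
  \<open>I\<close> alone.\<close>

lemma close_prob_measurable_PiM:
  assumes "finite I" "I \<noteq> {}" "I \<subseteq> J"
  shows "close_prob I c \<in> borel_measurable (PiM J (\<lambda>_. S))"
proof -
  let ?R = "(PiM J (\<lambda>_. S) \<Otimes>\<^sub>M P) \<Otimes>\<^sub>M P"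
  have w: "(\<lambda>z. fst (fst z)) \<in> ?R \<rightarrow>\<^sub>M PiM J (\<lambda>_. S)"
    and x: "(\<lambda>z. snd z) \<in> ?R \<rightarrow>\<^sub>M S" and y: "(\<lambda>z. snd (fst z)) \<in> ?R \<rightarrow>\<^sub>M S"
    by measurable
  note [measurable] = depth_emp_measurable[OF x w assms] depth_emp_measurable[OF y w assms]
  have "(\<lambda>z. if \<bar>D (snd z) (emp S I (fst (fst z))) - D (snd (fst z)) (emp S I (fst (fst z)))\<bar> \<le> c
      then 1 else 0 :: real) \<in> borel_measurable ?R"
    by measurable
  then have "(\<lambda>(z, x). of_bool (\<bar>D x (emp S I (fst z)) - D (snd z) (emp S I (fst z))\<bar> \<le> c) :: real)
      \<in> borel_measurable ?R"
    by (simp add: case_prod_beta of_bool_def)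
  from P.borel_measurable_lebesgue_integral[OF this]
  have "(\<lambda>(w, y). \<integral>x. of_bool (\<bar>D x (emp S I w) - D y (emp S I w)\<bar> \<le> c) \<partial>P :: real)
      \<in> borel_measurable (PiM J (\<lambda>_. S) \<Otimes>\<^sub>M P)"
    by (simp add: case_prod_beta)
  from P.borel_measurable_lebesgue_integral[OF this] show ?thesis
    unfolding close_prob_def by simp
qed

lemma close_prob_measurable:
  assumes "finite I" "I \<noteq> {}"
  shows "close_prob I c \<in> borel_measurable (iid P)"
  using close_prob_measurable_PiM[OF assms, of UNIV c] measurable_cong_sets[OF sets_iid refl] by blast

lemma depth_emp_fixed_measurable:
  assumes "finite I" "I \<noteq> {}" "w \<in> space (iid P)"
  shows "(\<lambda>x. D x (emp S I w)) \<in> borel_measurable S"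
  by (rule depth_emp_measurable[where J = UNIV])
    (use assms in \<open>auto simp: space_iid space_PiM PiE_def intro!: measurable_const\<close>)

lemma close_prob_bounds:
  assumes I: "finite I" "I \<noteq> {}" and w: "w \<in> space (iid P)"
  shows "0 \<le> close_prob I c w" "close_prob I c w \<le> 1"
proof -
  let ?g = "\<lambda>y x. of_bool (\<bar>D x (emp S I w) - D y (emp S I w)\<bar> \<le> c) :: real"
  show "0 \<le> close_prob I c w"
    unfolding close_prob_def by (intro Bochner_Integration.integral_nonneg) auto
  have g: "(\<lambda>(y, x). ?g y x) \<in> borel_measurable (P \<Otimes>\<^sub>M P)"
    using depth_emp_fixed_measurable[OF assms] by (simp add: of_bool_def)
  have "\<bar>close_prob I c w\<bar> \<le> 1"
    unfolding close_prob_def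
  proof (rule integral_abs_le)
    show "(\<lambda>y. \<integral>x. ?g y x \<partial>P) \<in> borel_measurable P"
      using P.borel_measurable_lebesgue_integral[OF g] .
    fix y assume y: "y \<in> space S"
    show "\<bar>\<integral>x. ?g y x \<partial>P\<bar> \<le> 1"
    proof (rule integral_abs_le)
      show "?g y \<in> borel_measurable P"
        using measurable_compose[OF measurable_Pair1'[of y P P] g] y by simp
    qed simp
  qed
  then show "close_prob I c w \<le> 1"
    by simp
qed

lemma abs_close_le: "\<bar>close I c a b w\<bar> \<le> 1"
  by (simp add: close_def)

lemma close_fun_upd: "i \<notin> I \<Longrightarrow> i \<noteq> a \<Longrightarrow> i \<noteq> b \<Longrightarrow> close I c a b (w(i := x)) = close I c a b w"
  by (simp add: close_def emp_fun_upd)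

lemma close_prob_fun_upd: "i \<notin> I \<Longrightarrow> close_prob I c (w(i := x)) = close_prob I c w"
  by (simp add: close_prob_def emp_fun_upd)

lemma abs_close_prob_le:
  "finite I \<Longrightarrow> I \<noteq> {} \<Longrightarrow> w \<in> space (iid P) \<Longrightarrow> \<bar>close_prob I c w\<bar> \<le> 1"
  using close_prob_bounds by simp

lemma close_prob_reindex:
  assumes "inj_on \<sigma> I" "finite I"
  shows "close_prob I c (\<lambda>i. w (\<sigma> i)) = close_prob (\<sigma> ` I) c w"
  by (simp add: close_prob_def emp_reindex[OF assms])

text \<open>Integrating out the coordinates \<open>a\<close> and \<open>b\<close> leaves
  \<open>U\<close> and the empirical measure untouched and turns \<open>close\<close> into
  \<open>close_prob\<close>. The factor \<open>U\<close> lets this serve as a mean (\<open>U\<close>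
  = 1), as a conditional expectation (\<open>U\<close> an indicator) and as a product formula
  (\<open>U\<close> another \<open>close\<close>).\<close>

lemma integral_mult_close:
  fixes U :: "(nat \<Rightarrow> 'a) \<Rightarrow> real"
  assumes I: "finite I" "I \<noteq> {}" and ab: "a \<noteq> b" "a \<notin> I" "b \<notin> I"
    and U: "U \<in> borel_measurable (iid P)" "\<And>w. w \<in> space (iid P) \<Longrightarrow> \<bar>U w\<bar> \<le> B"
    and inv: "\<And>w x. w \<in> space (iid P) \<Longrightarrow> x \<in> space S \<Longrightarrow> U (w(a := x)) = U w"
      "\<And>w x. w \<in> space (iid P) \<Longrightarrow> x \<in> space S \<Longrightarrow> U (w(b := x)) = U w"
  shows "(\<integral>w. U w * close I c a b w \<partial>iid P) = (\<integral>w. U w * close_prob I c w \<partial>iid P)"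
proof -
  define f where "f w = U w * close I c a b w" for w
  define h where "h w = (\<integral>x. f (w(a := x)) \<partial>P)" for w
  note [measurable] = U(1) close_measurable[OF I]
  have f [measurable]: "f \<in> borel_measurable (iid P)"
    unfolding f_def by measurable
  have fB: "\<bar>f w\<bar> \<le> B" if "w \<in> space (iid P)" for w
    using U(2)[OF that] by (auto simp: f_def close_def)
  have upd: "w(i := x) \<in> space (iid P)" if "w \<in> space (iid P)" "x \<in> space S" for w i x
    using that by (auto simp: space_iid)
  have fm: "case_prod (\<lambda>w x. f (w(i := x))) \<in> borel_measurable (iid P \<Otimes>\<^sub>M P)" for i
  proof -
    have "(\<lambda>z. f (case_prod (\<lambda>x w. w(i := x)) z)) \<in> borel_measurable (P \<Otimes>\<^sub>M iid P)"
      by (rule measurable_compose[OF fun_upd_iid_measurable f])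
    from measurable_compose[OF measurable_pair_swap' this] show ?thesis
      by (simp only: case_prod_unfold fst_conv snd_conv)
  qed
  have h [measurable]: "h \<in> borel_measurable (iid P)"
    unfolding h_def by (rule P.borel_measurable_lebesgue_integral[OF fm])
  have hB: "\<bar>h w\<bar> \<le> B" if w: "w \<in> space (iid P)" for w
    unfolding h_def
  proof (rule integral_abs_le)
    from measurable_compose[OF measurable_Pair1'[OF w] fm[of a]] show "(\<lambda>x. f (w(a := x))) \<in> borel_measurable P"
      by (simp only: case_prod_conv)
    show "\<bar>f (w(a := x))\<bar> \<le> B" if "x \<in> space S" for x
      by (rule fB[OF upd[OF w that]])
  qed
  have "(\<integral>w. f w \<partial>iid P) = (\<integral>w. h w \<partial>iid P)"
    unfolding h_def by (rule integral_fun_upd[OF f fB])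
  also have "\<dots> = (\<integral>w. \<integral>y. h (w(b := y)) \<partial>P \<partial>iid P)"
    by (rule integral_fun_upd[OF h hB])
  also have "\<dots> = (\<integral>w. U w * close_prob I c w \<partial>iid P)"
  proof (rule Bochner_Integration.integral_cong[OF refl])
    fix w assume w: "w \<in> space (iid P)"
    have "h (w(b := y)) = U w * (\<integral>x. of_bool (\<bar>D x (emp S I w) - D y (emp S I w)\<bar> \<le> c) \<partial>P)"
      if y: "y \<in> space S" for y
    proof -
      have "f (w(b := y, a := x)) = U w * of_bool (\<bar>D x (emp S I w) - D y (emp S I w)\<bar> \<le> c)"
        if x: "x \<in> space S" for x
      proof -
        have "U (w(b := y, a := x)) = U w"
          using inv(1)[OF upd[OF w y] x] inv(2)[OF w y] by simp
        moreover have "emp S I (w(b := y, a := x)) = emp S I w"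
          using ab by (intro emp_cong) auto
        moreover have "(w(b := y, a := x)) a = x" "(w(b := y, a := x)) b = y"
          using ab(1) by simp_all
        ultimately show ?thesis
          by (simp only: f_def close_def)
      qed
      then have "h (w(b := y)) =
          (\<integral>x. U w * of_bool (\<bar>D x (emp S I w) - D y (emp S I w)\<bar> \<le> c) \<partial>P)"
        unfolding h_def by (intro Bochner_Integration.integral_cong) auto
      then show ?thesis
        by simp
    qed
    then have "(\<integral>y. h (w(b := y)) \<partial>P) =
        (\<integral>y. U w * (\<integral>x. of_bool (\<bar>D x (emp S I w) - D y (emp S I w)\<bar> \<le> c) \<partial>P) \<partial>P)"
      by (intro Bochner_Integration.integral_cong) auto
    then show "(\<integral>y. h (w(b := y)) \<partial>P) = U w * close_prob I c w"
      by (simp add: close_prob_def)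
  qed
  finally show ?thesis
    by (simp add: f_def)
qed

lemma integral_close:
  assumes "finite I" "I \<noteq> {}" "a \<noteq> b" "a \<notin> I" "b \<notin> I"
  shows "(\<integral>w. close I c a b w \<partial>iid P) = (\<integral>w. close_prob I c w \<partial>iid P)"
  using integral_mult_close[OF assms, of "\<lambda>_. 1" 1] by simp

text \<open>Given the coordinates in \<open>I\<close>, the two events concern disjoint pairs of
  independent observations, hence are conditionally independent with the same conditional
  probability.\<close>

lemma integral_close_mult_close:
  assumes I: "finite I" "I \<noteq> {}" and "a \<notin> I" "b \<notin> I" "a' \<notin> I" "b' \<notin> I" "distinct [a, b, a', b']"
  shows "(\<integral>w. close I c a b w * close I c a' b' w \<partial>iid P) = (\<integral>w. (close_prob I c w)\<^sup>2 \<partial>iid P)"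
proof -
  have d: "a \<noteq> b" "a' \<noteq> b'" "a \<noteq> a'" "a \<noteq> b'" "b \<noteq> a'" "b \<noteq> b'"
    using assms(7) by auto
  have "(\<integral>w. close I c a' b' w * close I c a b w \<partial>iid P)
      = (\<integral>w. close I c a' b' w * close_prob I c w \<partial>iid P)"
    by (rule integral_mult_close[OF I d(1) assms(3,4) close_measurable[OF I] abs_close_le])
      (simp_all add: close_fun_upd assms(3,4) d)
  also have "\<dots> = (\<integral>w. close_prob I c w * close I c a' b' w \<partial>iid P)"
    by (simp only: mult.commute)
  also have "\<dots> = (\<integral>w. close_prob I c w * close_prob I c w \<partial>iid P)"
    by (rule integral_mult_close[OF I d(2) assms(5,6) close_prob_measurable[OF I] abs_close_prob_le[OF I]])
      (simp_all add: close_prob_fun_upd assms(3,4) assms(5,6))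
  finally show ?thesis
    by (simp only: power2_eq_square mult.commute)
qed

section \<open>The conditional probability of \<open>Asm4\<close> as an explicit integral\<close>

lemma coord_algebra_measurable:
  assumes "f \<in> borel_measurable (PiM I (\<lambda>_. S))" and "\<And>w. f (restrict w I) = f w"
  shows "f \<in> borel_measurable (coord_algebra P I)"
proof -
  have "(\<lambda>w. restrict w I) \<in> coord_algebra P I \<rightarrow>\<^sub>M PiM I (\<lambda>_. P)"
    unfolding coord_algebra_def
    by (rule measurable_vimage_algebra1) (auto simp: space_iid space_PiM)
  moreover have "f \<in> borel_measurable (PiM I (\<lambda>_. P))"
    using assms(1) by (simp cong: measurable_cong_sets sets_PiM_cong)
  ultimately have "(\<lambda>w. f (restrict w I)) \<in> borel_measurable (coord_algebra P I)"
    by (rule measurable_compose)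
  then show ?thesis
    by (simp add: assms(2))
qed


lemma coord_algebra_subalgebra: "subalgebra (iid P) (coord_algebra P I)"
proof -
  have "sets (coord_algebra P I) \<subseteq> sets (iid P)"
    unfolding coord_algebra_def
  proof (rule sets_image_in_sets)
    show "(\<lambda>w. restrict w I) \<in> iid P \<rightarrow>\<^sub>M PiM I (\<lambda>_. P)"
      by measurable
  qed simp
  then show ?thesis
    by (simp add: subalgebra_def coord_algebra_def)
qed

text \<open>An event determined by the coordinates in \<open>I\<close> does not react to a change at
  \<open>a\<close> or \<open>b\<close>, so its indicator is admissible as \<open>U\<close> in
  \<open>integral_mult_close\<close>. That yields the defining property of the conditional
  expectation.\<close>

lemma real_cond_exp_close:
  assumes I: "finite I" "I \<noteq> {}" and ab: "a \<noteq> b" "a \<notin> I" "b \<notin> I"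
  shows "AE w in iid P. real_cond_exp (iid P) (coord_algebra P I) (close I c a b) w = close_prob I c w"
proof -
  note [measurable] = close_measurable[OF I] close_prob_measurable[OF I]
  interpret finite_measure_subalgebra "iid P" "coord_algebra P I"
    by unfold_locales (rule coord_algebra_subalgebra)
  show ?thesis
  proof (rule real_cond_exp_charact)
    fix A assume A: "A \<in> sets (coord_algebra P I)"
    then have A_iid [measurable]: "A \<in> sets (iid P)"
      using coord_algebra_subalgebra by (auto simp: subalgebra_def)
    from A obtain A' where A': "A = (\<lambda>w. restrict w I) -` A' \<inter> space (iid P)"
      unfolding coord_algebra_def
      by (subst (asm) sets_vimage_algebra2) (auto simp: space_iid space_PiM)
    have inv: "indicator A (w(i := x)) = (indicator A w :: real)"
      if "w \<in> space (iid P)" "x \<in> space S" "i \<notin> I" for w x i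
    proof -
      have "restrict (w(i := x)) I = restrict w I"
        using that by (auto simp: restrict_def)
      then show ?thesis
        using that by (auto simp: A' space_iid split: split_indicator)
    qed
    show "(\<integral>w\<in>A. close I c a b w \<partial>iid P) = (\<integral>w\<in>A. close_prob I c w \<partial>iid P)"
      unfolding set_lebesgue_integral_def real_scaleR_def
      by (rule integral_mult_close[where B = 1]) (use I ab inv in auto)
  next
    show "integrable (iid P) (close I c a b)"
      by (rule iid.integrable_const_bound[where B = 1]) (auto simp: close_def)
    show "integrable (iid P) (close_prob I c)"
      by (rule iid.integrable_const_bound[where B = 1]) (auto simp: close_prob_bounds[OF I])
    show "close_prob I c \<in> borel_measurable (coord_algebra P I)"
      by (rule coord_algebra_measurable[OF close_prob_measurable_PiM[OF I subset_refl]])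
        (simp add: close_prob_def cong: emp_cong)
  qed
qed


section \<open>\<open>Asm3\<close> and \<open>Asm4\<close> for arbitrary index sets\<close>

lemma depth_emp_perturb:
  assumes "Asm3 S D P"
  obtains c where "0 < c"
    and "\<forall>\<^sub>F m in sequentially. \<forall>I a. finite I \<longrightarrow> card I = m \<longrightarrow> a \<in> I \<longrightarrow>
      (AE w in iid P. \<forall>x\<in>space S. \<bar>D x (emp S I w) - D x (emp S (I - {a}) w)\<bar> \<le> c / real m)"
proof -
  from assms obtain C m0 where C: "AE w in iid P.
      sup_dev S D (emp S {1..m} w) (emp S ({1..m} - {1}) w) \<le> ennreal (C / real m)" if "m \<ge> m0" for m
    unfolding Asm3_def by blast
  \<comment> \<open>The constant in \<open>Asm3\<close> may be nonpositive. Raising it to at least 1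
    makes it admissible for \<open>Asm4\<close> and lets the \<open>ennreal\<close> bound be read
    back in the reals.\<close>
  define c where "c = max C 1"
  have "AE w in iid P. \<forall>x\<in>space S. \<bar>D x (emp S I w) - D x (emp S (I - {a}) w)\<bar> \<le> c / real m"
    if m: "m \<ge> m0" and I: "finite I" "card I = m" "a \<in> I" for m I a
  proof -
    obtain \<sigma> where \<sigma>: "inj \<sigma>" "\<sigma> ` {1..m} = I" "\<sigma> 1 = a"
      using ex_inj_bij_betw[OF I, of "{}"] by auto
    have inj: "inj_on \<sigma> A" for A
      using \<sigma>(1) inj_on_subset by blast
    have "\<sigma> ` ({1..m} - {1}) = I - {a}"
      using image_set_diff[OF \<sigma>(1)] \<sigma>(2,3) by auto
    then have e: "emp S {1..m} (\<lambda>i. w (\<sigma> i)) = emp S I w"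
      "emp S ({1..m} - {1}) (\<lambda>i. w (\<sigma> i)) = emp S (I - {a}) w" for w
      using emp_reindex[OF inj, of "{1..m}" S w] emp_reindex[OF inj, of "{1..m} - {1}" S w] \<sigma>(2)
      by simp_all
    have "0 < c"
      by (simp add: c_def)
    have "AE w in iid P. sup_dev S D (emp S I w) (emp S (I - {a}) w) \<le> ennreal (C / real m)"
      using AE_reindex[OF \<sigma>(1) C[OF m]] unfolding e .
    then show ?thesis
    proof (eventually_elim, intro ballI)
      fix w x assume w: "sup_dev S D (emp S I w) (emp S (I - {a}) w) \<le> ennreal (C / real m)"
        and x: "x \<in> space S"
      have "ennreal \<bar>D x (emp S I w) - D x (emp S (I - {a}) w)\<bar> \<le> ennreal (C / real m)"
        using w x unfolding sup_dev_def by (metis (no_types, lifting) SUP_upper order_trans)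
      also have "\<dots> \<le> ennreal (c / real m)"
        by (intro ennreal_leI divide_right_mono) (auto simp: c_def)
      finally show "\<bar>D x (emp S I w) - D x (emp S (I - {a}) w)\<bar> \<le> c / real m"
        using \<open>0 < c\<close> by (subst (asm) ennreal_le_iff) auto
    qed
  qed
  then show ?thesis
    by (intro that[of c] eventually_mono[OF eventually_ge_at_top[of m0]]) (auto simp: c_def)
qed

text \<open>In \<open>Asm4\<close> the tolerance is C / m while the empirical measure has m - 1
  points, hence \<open>Suc (card I) = m\<close>.\<close>

lemma integral_close_prob_square:
  assumes "Asm4 S D P \<beta>" "0 < c"
  obtains K where "0 \<le> K"
    and "\<forall>\<^sub>F m in sequentially. \<forall>I. finite I \<longrightarrow> Suc (card I) = m \<longrightarrow>
      (\<integral>w. (close_prob I (c / real m) w)\<^sup>2 \<partial>iid P) \<le> K * real m powr (- 2 * \<beta>)"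
proof -
  define A where "A m = {w \<in> space (iid P).
      \<bar>D (w 1) (emp S ({1..m} - {1}) w) - D (w 0) (emp S ({1..m} - {1}) w)\<bar> \<le> c / real m}" for m
  define F where "F m = (\<integral>w. (real_cond_exp (iid P) (coord_algebra P {2..m}) (indicator (A m)) w)\<^sup>2 \<partial>iid P)"
    for m
  have "F \<in> O(\<lambda>m. real m powr (- 2 * \<beta>))"
    using assms unfolding Asm4_def F_def A_def by blast
  then obtain K where K: "0 < K" "\<forall>\<^sub>F m in sequentially. norm (F m) \<le> K * norm (real m powr (- 2 * \<beta>))"
    by (elim landau_o.bigE)
  have F: "F m = (\<integral>w. (close_prob I (c / real m) w)\<^sup>2 \<partial>iid P)"
    if m: "2 \<le> m" and I: "finite I" "Suc (card I) = m" for m and I :: "nat set"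
  proof -
    let ?J = "{2..m}"
    have J: "{1..m} - {1} = ?J" "?J \<noteq> {}"
      using m by auto
    \<comment> \<open>A fresh index stands for the observation deleted in \<open>Asm4\<close>: a map
      taking 1 to \<open>a\<close> and {1..m} onto \<open>insert a I\<close> takes {2..m} onto
      \<open>I\<close>.\<close>
    obtain a where a: "a \<notin> I"
      using ex_new_if_finite[OF infinite_UNIV_nat I(1)] by blast
    obtain \<sigma> where \<sigma>: "inj \<sigma>" "\<sigma> ` {1..m} = insert a I" "\<sigma> 1 = a"
      using ex_inj_bij_betw[of "insert a I" m a "{}"] I a by auto
    have inj: "inj_on \<sigma> ?J"
      using \<sigma>(1) inj_on_subset by blast
    have \<sigma>J: "\<sigma> ` ?J = I"
      using image_set_diff[OF \<sigma>(1), of "{1..m}" "{1}"] \<sigma>(2,3) a unfolding J by auto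
    note [measurable] = close_prob_measurable[OF finite_atLeastAtMost J(2)]
      close_measurable[OF finite_atLeastAtMost J(2)]
    have Am: "indicator (A m) w = close ?J (c / real m) 1 0 w" if "w \<in> space (iid P)" for w
      using that unfolding A_def close_def J by (simp add: indicator_def)
    interpret finite_measure_subalgebra "iid P" "coord_algebra P ?J"
      by unfold_locales (rule coord_algebra_subalgebra)
    have Am_meas: "indicat_real (A m) \<in> borel_measurable (iid P)"
      using measurable_cong[of "iid P" "indicator (A m)" "close ?J (c / real m) 1 0" borel] Am
        close_measurable[OF finite_atLeastAtMost J(2)] by blast
    have "AE w in iid P. real_cond_exp (iid P) (coord_algebra P ?J) (indicator (A m)) w =
        real_cond_exp (iid P) (coord_algebra P ?J) (close ?J (c / real m) 1 0) w"
      by (rule real_cond_exp_cong) (use Am Am_meas in auto)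
    moreover have "AE w in iid P.
        real_cond_exp (iid P) (coord_algebra P ?J) (close ?J (c / real m) 1 0) w = close_prob ?J (c / real m) w"
      by (rule real_cond_exp_close) (use J in auto)
    ultimately have "F m = (\<integral>w. (close_prob ?J (c / real m) w)\<^sup>2 \<partial>iid P)"
      unfolding F_def by (intro integral_cong_AE) auto
    also have "\<dots> = (\<integral>w. (close_prob ?J (c / real m) (\<lambda>i. w (\<sigma> i)))\<^sup>2 \<partial>iid P)"
      by (rule integral_reindex[OF \<sigma>(1), symmetric]) measurable
    finally show ?thesis
      by (simp only: close_prob_reindex[OF inj finite_atLeastAtMost] \<sigma>J)
  qed
  show ?thesis
  proof (rule that)
    show "0 \<le> K"
      using K by simp
    show "\<forall>\<^sub>F m in sequentially. \<forall>I. finite I \<longrightarrow> Suc (card I) = m \<longrightarrow>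
        (\<integral>w. (close_prob I (c / real m) w)\<^sup>2 \<partial>iid P) \<le> K * real m powr (- 2 * \<beta>)"
      using K(2) eventually_ge_at_top[of 2]
    proof (eventually_elim, intro allI impI)
      fix m and I :: "nat set" assume m: "norm (F m) \<le> K * norm (real m powr (- 2 * \<beta>))" "2 \<le> m"
        and I: "finite I" "Suc (card I) = m"
      show "(\<integral>w. (close_prob I (c / real m) w)\<^sup>2 \<partial>iid P) \<le> K * real m powr (- 2 * \<beta>)"
        using m(1) unfolding F[OF m(2) I, symmetric] by simp
    qed
  qed
qed


section \<open>Sign changes caused by the empirical depth\<close>

text \<open>The sign agrees, up to an affine map, with the indicator of < plus half that of =, and
  it is odd in the pair (a, b), ties included.\<close>

definition gap :: "nat set \<Rightarrow> nat \<Rightarrow> nat \<Rightarrow> (nat \<Rightarrow> 'a) \<Rightarrow> real" where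
  "gap I a b w = sgn (D (w b) (emp S I w) - D (w a) (emp S I w)) - sgn (D (w b) P - D (w a) P)"

lemma gap_measurable:
  assumes "finite I" "I \<noteq> {}"
  shows "gap I a b \<in> borel_measurable (iid P)"
proof -
  note [measurable] = depth_emp_iid_measurable[OF assms]
  show ?thesis
    unfolding gap_def by measurable
qed

lemma abs_gap_le: "\<bar>gap I a b w\<bar> \<le> 2"
  by (auto simp: gap_def sgn_if)

text \<open>The outer expectation is an infimum, so the strict inequality selects a measurable
  majorant of mean below \<open>e\<close>. It is reindexed by a map whose range avoids
  \<open>b\<close>, so that \<open>G\<close> stays fixed while the observation at \<open>b\<close>
  is integrated out. It is infinite on a null set only and can be made real valued.\<close>

lemma sup_dev_majorant:
  assumes out: "outer_expectation (iid P) (\<lambda>w. ennreal_powr (sup_dev S D (emp S {1..m} w) P) p) < ennreal e"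
    and p: "0 < p" and J: "finite J" "card J = m" "J \<noteq> {}" "b \<notin> J"
  obtains G :: "(nat \<Rightarrow> 'a) \<Rightarrow> real" where "integrable (iid P) G" "(\<integral>w. G w \<partial>iid P) \<le> e"
    "\<forall>w. 0 \<le> G w" "\<forall>w x. G (w(b := x)) = G w"
    "AE w in iid P. \<forall>x\<in>space S. \<bar>D x (emp S J w) - D x P\<bar> \<le> G w powr (1 / p)"
proof -
  have e: "0 < e"
    using out by (metis ennreal_eq_0_iff linorder_not_le not_less_zero)
  obtain g where g: "g \<in> borel_measurable (iid P)"
    "\<And>w. w \<in> space (iid P) \<Longrightarrow> ennreal_powr (sup_dev S D (emp S {1..m} w) P) p \<le> g w"
    "(\<integral>\<^sup>+ w. g w \<partial>iid P) < ennreal e"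
    using out unfolding outer_expectation_def INF_less_iff by blast
  note [measurable] = g(1)
  obtain a where a: "a \<in> J"
    using J by blast
  have b: "finite {b}" "{b} \<inter> J = {}"
    using J(4) by auto
  obtain \<sigma> where \<sigma>: "inj \<sigma>" "\<sigma> ` {1..m} = J" "range \<sigma> \<inter> {b} = {}"
    using ex_inj_bij_betw[OF J(1,2) a b] by metis
  have inj: "inj_on \<sigma> {1..m}"
    using \<sigma>(1) inj_on_subset by blast
  have empJ: "emp S {1..m} (\<lambda>i. w (\<sigma> i)) = emp S J w" for w
    using emp_reindex[OF inj, of S w] \<sigma>(2) by simp
  define g' where "g' w = g (\<lambda>i. w (\<sigma> i))" for w
  have [measurable]: "g' \<in> borel_measurable (iid P)"
    unfolding g'_def by (rule measurable_compose[OF reindex_measurable g(1)])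
  have "(\<integral>\<^sup>+ w. g w \<partial>iid P) = (\<integral>\<^sup>+ w. g w \<partial>distr (iid P) (iid P) (\<lambda>w i. w (\<sigma> i)))"
    by (simp only: distr_iid_reindex[OF \<sigma>(1)])
  also have "\<dots> = (\<integral>\<^sup>+ w. g' w \<partial>iid P)"
    unfolding g'_def by (rule nn_integral_distr) (simp_all add: reindex_measurable g(1))
  finally have g'_int: "(\<integral>\<^sup>+ w. g' w \<partial>iid P) < ennreal e"
    using g(3) by simp
  define G where "G w = enn2real (g' w)" for w
  have [measurable]: "G \<in> borel_measurable (iid P)"
    unfolding G_def by measurable
  have G_int: "(\<integral>\<^sup>+ w. ennreal (G w) \<partial>iid P) \<le> ennreal e"
  proof -
    have "(\<integral>\<^sup>+ w. ennreal (G w) \<partial>iid P) \<le> (\<integral>\<^sup>+ w. g' w \<partial>iid P)"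
      unfolding G_def by (intro nn_integral_mono) (metis ennreal_enn2real_if le_cases zero_le)
    then show ?thesis
      using g'_int by simp
  qed
  have intG: "integrable (iid P) G"
    by (rule integrableI_bounded)
      (use G_int in \<open>auto simp: G_def intro: le_less_trans[OF _ ennreal_less_top]\<close>)
  moreover have "(\<integral>w. G w \<partial>iid P) \<le> e"
  proof -
    have "ennreal (\<integral>w. G w \<partial>iid P) = (\<integral>\<^sup>+ w. ennreal (G w) \<partial>iid P)"
      by (rule nn_integral_eq_integral[symmetric, OF intG]) (simp add: G_def)
    then show ?thesis
      using G_int e by (metis ennreal_le_iff less_imp_le)
  qed
  moreover have "\<forall>w x. G (w(b := x)) = G w"
  proof (intro allI)
    fix w :: "nat \<Rightarrow> 'a" and x
    have "(\<lambda>i. (w(b := x)) (\<sigma> i)) = (\<lambda>i. w (\<sigma> i))"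
      using \<sigma>(3) by (intro ext) auto
    then show "G (w(b := x)) = G w"
      by (simp only: G_def g'_def)
  qed
  moreover have "AE w in iid P. \<forall>x\<in>space S. \<bar>D x (emp S J w) - D x P\<bar> \<le> G w powr (1 / p)"
  proof -
    have "AE w in iid P. g' w \<noteq> \<infinity>"
      by (rule nn_integral_PInf_AE) (use g'_int in auto)
    then show ?thesis
      using AE_space
    proof (eventually_elim, intro ballI)
      fix w x assume fin: "g' w \<noteq> \<infinity>" and w: "w \<in> space (iid P)" and x: "x \<in> space S"
      define s where "s = sup_dev S D (emp S J w) P"
      have "(\<lambda>i. w (\<sigma> i)) \<in> space (iid P)"
        using w by (auto simp: space_iid)
      from g(2)[OF this] have s: "ennreal_powr s p \<le> g' w"
        unfolding empJ s_def g'_def .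
      have "g' w < \<top>"
        using fin by (simp add: top.not_eq_extremum)
      then have s_fin: "s \<noteq> \<top>"
        using s by (auto simp: ennreal_powr_def)
      have "\<bar>D x (emp S J w) - D x P\<bar> \<le> enn2real s"
      proof -
        have "ennreal \<bar>D x (emp S J w) - D x P\<bar> \<le> s"
          unfolding s_def sup_dev_def using x by (rule SUP_upper)
        also have "s = ennreal (enn2real s)"
          using s_fin by (simp add: top.not_eq_extremum)
        finally show ?thesis
          by (subst (asm) ennreal_le_iff) auto
      qed
      moreover have "enn2real s powr p \<le> G w"
      proof -
        have "ennreal (enn2real s powr p) \<le> g' w"
          using s s_fin by (simp add: ennreal_powr_def)
        then have "enn2real (ennreal (enn2real s powr p)) \<le> enn2real (g' w)"
          using \<open>g' w < \<top>\<close> by (rule enn2real_mono)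
        then show ?thesis
          by (simp add: G_def)
      qed
      then have "(enn2real s powr p) powr (1 / p) \<le> G w powr (1 / p)"
        using p by (intro powr_mono2) auto
      then have "enn2real s \<le> G w powr (1 / p)"
        using p by (simp add: powr_powr)
      ultimately show "\<bar>D x (emp S J w) - D x P\<bar> \<le> G w powr (1 / p)"
        by linarith
    qed
  qed
  ultimately show ?thesis
    using that[of G] by (simp add: G_def)
qed


lemma prob_depth_interval:
  assumes C: "\<And>y1 y2. 0 \<le> y1 \<Longrightarrow> 0 \<le> y2 \<Longrightarrow>
      measure P {x \<in> space P. D x P \<in> {y1..y2}} \<le> C * \<bar>y2 - y1\<bar> powr \<beta>"
    and "0 \<le> d" "0 \<le> r" "0 \<le> \<beta>" "0 \<le> C"
  shows "(\<integral>x. of_bool (\<bar>D x P - d\<bar> \<le> r) \<partial>P) \<le> C * (2 * r) powr \<beta>"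
proof -
  have nonneg: "0 \<le> D x P" if "x \<in> space S" for x
    using depth P_prob that by (auto simp: depth_function_def)
  \<comment> \<open>\<open>Asm1\<close> speaks of nonnegative endpoints only. Depths are
    nonnegative, so cutting the interval at 0 loses no points.\<close>
  let ?A = "{x \<in> space P. D x P \<in> {max 0 (d - r)..d + r}}"
  have "(\<integral>x. of_bool (\<bar>D x P - d\<bar> \<le> r) \<partial>P) = (\<integral>x. indicator ?A x \<partial>P)"
    by (rule Bochner_Integration.integral_cong) (use nonneg in \<open>auto simp: indicator_def abs_le_iff\<close>)
  also have "\<dots> = measure P ?A"
    by simp
  also have "\<dots> \<le> C * \<bar>d + r - max 0 (d - r)\<bar> powr \<beta>"
    by (rule C) (use assms in auto)
  also have "\<dots> \<le> C * (2 * r) powr \<beta>"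
    using assms by (intro mult_left_mono powr_mono2) auto
  finally show ?thesis .
qed

text \<open>A nonzero \<open>gap\<close> forces the two true depths to lie within twice the sup
  deviation of each other. Since the majorant of the deviation is free of the observation at
  \<open>b\<close>, integrating that observation out and applying \<open>Asm1\<close> leaves a
  multiple of the square root of \<open>G\<close>; the mean of \<open>G\<close> is O(m^(-\<beta>))
  by \<open>Asm2\<close>.\<close>

lemma integral_gap:
  assumes "Asm1 D P \<beta>" "Asm2 S D P \<beta>" "0 < \<beta>"
  obtains K where "0 \<le> K"
    and "\<forall>\<^sub>F m in sequentially. \<forall>J a b. finite J \<longrightarrow> card J = m \<longrightarrow> b \<notin> J \<longrightarrow> a \<noteq> b \<longrightarrow>
      (\<integral>w. \<bar>gap J a b w\<bar> \<partial>iid P) \<le> K * real m powr (- \<beta> / 2)"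
proof -
  from assms(1) obtain C1 where C1: "0 < C1" "\<And>y1 y2. 0 \<le> y1 \<Longrightarrow> 0 \<le> y2 \<Longrightarrow>
      measure P {x \<in> space P. D x P \<in> {y1..y2}} \<le> C1 * \<bar>y2 - y1\<bar> powr \<beta>"
    unfolding Asm1_def by blast
  from assms(2) obtain C2 where C2: "\<forall>\<^sub>F m in sequentially.
      outer_expectation (iid P) (\<lambda>w. ennreal_powr (sup_dev S D (emp S {1..m} w) P) (2 * \<beta>))
        \<le> ennreal (C2 * real m powr (- \<beta>))"
    unfolding Asm2_def by blast
  \<comment> \<open>The 4 is 2 * 2: \<open>R\<close> is twice the deviation, and an interval of
    radius \<open>R\<close> has length 2 R. Of the last factor, \<bar>C2\<bar> + 1 belongs to the
    mean of \<open>G\<close> and the other 1 to the second AM-GM term.\<close>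
  define K where "K = C1 * 4 powr \<beta> * (\<bar>C2\<bar> + 2)"
  show ?thesis
  proof (rule that)
    show "0 \<le> K"
      using C1 by (simp add: K_def)
    show "\<forall>\<^sub>F m in sequentially. \<forall>J a b. finite J \<longrightarrow> card J = m \<longrightarrow> b \<notin> J \<longrightarrow> a \<noteq> b \<longrightarrow>
      (\<integral>w. \<bar>gap J a b w\<bar> \<partial>iid P) \<le> K * real m powr (- \<beta> / 2)"
      using C2 eventually_ge_at_top[of 1]
    proof (eventually_elim, intro allI impI)
      fix m :: nat and J :: "nat set" and a b :: nat
      assume out: "outer_expectation (iid P) (\<lambda>w. ennreal_powr (sup_dev S D (emp S {1..m} w) P) (2 * \<beta>))
          \<le> ennreal (C2 * real m powr (- \<beta>))"
        and m: "1 \<le> m" and J: "finite J" "card J = m" "b \<notin> J" and ab: "a \<noteq> b"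
      \<comment> \<open>The extra 1 makes the bound strict, as the selection of a majorant requires;
        the absolute value covers either sign of \<open>C2\<close>.\<close>
      define e where "e = (\<bar>C2\<bar> + 1) * real m powr (- \<beta>)"
      have "C2 * real m powr (- \<beta>) < e" "0 < e"
        unfolding e_def using m by (auto intro!: mult_strict_right_mono mult_pos_pos)
      then have "ennreal (C2 * real m powr (- \<beta>)) < ennreal e"
        by (metis ennreal_lessI)
      with out have out_less:
        "outer_expectation (iid P) (\<lambda>w. ennreal_powr (sup_dev S D (emp S {1..m} w) P) (2 * \<beta>)) < ennreal e"
        by (rule le_less_trans)
      have J_ne: "J \<noteq> {}"
        using J(2) m by auto
      have p: "0 < 2 * \<beta>"
        using assms(3) by simp
      obtain G where G: "integrable (iid P) G" "(\<integral>w. G w \<partial>iid P) \<le> e"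
        and G34: "\<forall>w. 0 \<le> G w" "\<forall>w x. G (w(b := x)) = G w"
        and G5: "AE w in iid P. \<forall>x\<in>space S. \<bar>D x (emp S J w) - D x P\<bar> \<le> G w powr (1 / (2 * \<beta>))"
        by (rule sup_dev_majorant[OF out_less p J(1,2) J_ne J(3)]) (rule that; assumption)
      note G = G G34[rule_format] G5
      have G_meas [measurable]: "G \<in> borel_measurable (iid P)"
        using G(1) by (rule borel_measurable_integrable)
      define R where "R w = 2 * G w powr (1 / (2 * \<beta>))" for w
      have [measurable]: "R \<in> borel_measurable (iid P)"
        unfolding R_def by measurable
      define f :: "(nat \<Rightarrow> 'a) \<Rightarrow> real" where "f w = of_bool (\<bar>D (w b) P - D (w a) P\<bar> \<le> R w)" for w
      have f_meas: "f \<in> borel_measurable (iid P)"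
        unfolding f_def of_bool_def by measurable
      have f_bd: "\<bar>f w\<bar> \<le> 1" for w
        by (simp add: f_def)
      have int_f: "integrable (iid P) f"
        by (rule iid.integrable_const_bound[where B = 1]) (auto simp: f_bd f_meas)
      have int_gap: "integrable (iid P) (\<lambda>w. \<bar>gap J a b w\<bar>)"
        by (rule integrable_abs, rule iid.integrable_const_bound[where B = 2])
          (auto simp: abs_gap_le gap_measurable[OF J(1) J_ne])
      have "AE w in iid P. \<bar>gap J a b w\<bar> \<le> 2 * f w"
        using G(5) AE_space
      proof eventually_elim
        fix w assume close: "\<forall>x\<in>space S. \<bar>D x (emp S J w) - D x P\<bar> \<le> G w powr (1 / (2 * \<beta>))"
          and w: "w \<in> space (iid P)"
        have "w a \<in> space S" "w b \<in> space S"
          using w by (auto simp: space_iid)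
        then have "\<bar>(D (w b) (emp S J w) - D (w a) (emp S J w)) - (D (w b) P - D (w a) P)\<bar> \<le> R w"
          using bspec[OF close, of "w a"] bspec[OF close, of "w b"] unfolding R_def by linarith
        from abs_sgn_diff_le[OF this] show "\<bar>gap J a b w\<bar> \<le> 2 * f w"
          by (simp only: gap_def f_def)
      qed
      then have "(\<integral>w. \<bar>gap J a b w\<bar> \<partial>iid P) \<le> (\<integral>w. 2 * f w \<partial>iid P)"
        using int_f int_gap by (intro integral_mono_AE) auto
      also have "\<dots> = 2 * (\<integral>w. f w \<partial>iid P)"
        by simp
      also have "(\<integral>w. f w \<partial>iid P) = (\<integral>w. \<integral>x. f (w(b := x)) \<partial>P \<partial>iid P)"
        by (rule integral_fun_upd[OF f_meas f_bd])
      also have "\<dots> \<le> (\<integral>w. C1 * 4 powr \<beta> / 2 * (real m powr (\<beta> / 2) * G w + real m powr (- \<beta> / 2)) \<partial>iid P)"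
      proof (rule integral_mono_AE')
        show "integrable (iid P) (\<lambda>w. C1 * 4 powr \<beta> / 2 * (real m powr (\<beta> / 2) * G w + real m powr (- \<beta> / 2)))"
          using G(1) by auto
        show "AE w in iid P. (\<integral>x. f (w(b := x)) \<partial>P)
            \<le> C1 * 4 powr \<beta> / 2 * (real m powr (\<beta> / 2) * G w + real m powr (- \<beta> / 2))"
        proof (rule AE_I2)
          fix w assume w: "w \<in> space (iid P)"
          have "0 \<le> D (w a) P"
            using depth P_prob w by (auto simp: depth_function_def space_iid)
          have "R (w(b := x)) = R w" for x
            by (simp only: R_def G(4))
          then have "(\<integral>x. f (w(b := x)) \<partial>P) = (\<integral>x. of_bool (\<bar>D x P - D (w a) P\<bar> \<le> R w) \<partial>P)"
            using ab by (simp add: f_def)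
          also have "\<dots> \<le> C1 * (2 * R w) powr \<beta>"
            by (rule prob_depth_interval[OF C1(2) \<open>0 \<le> D (w a) P\<close>]) (use C1 assms(3) G(3) in \<open>auto simp: R_def\<close>)
          also have "(2 * R w) powr \<beta> = 4 powr \<beta> * sqrt (G w)"
          proof -
            have "2 * R w = 4 * G w powr (1 / (2 * \<beta>))"
              by (simp add: R_def)
            then have "(2 * R w) powr \<beta> = 4 powr \<beta> * (G w powr (1 / (2 * \<beta>))) powr \<beta>"
              by (simp only: powr_mult[of 4 "G w powr (1 / (2 * \<beta>))" \<beta>])
            also have "(G w powr (1 / (2 * \<beta>))) powr \<beta> = sqrt (G w)"
              using assms(3) G(3)[of w] by (simp add: powr_powr powr_half_sqrt)
            finally show ?thesis .
          qed
          also have "C1 * (4 powr \<beta> * sqrt (G w))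
              \<le> C1 * (4 powr \<beta> * ((real m powr (\<beta> / 2) * G w + real m powr (- \<beta> / 2)) / 2))"
          proof (intro mult_left_mono)
            \<comment> \<open>AM-GM, weighted so that both terms have mean of order m^(-\<beta>/2);
              it stands in for Jensen's inequality.\<close>
            have "sqrt (G w) = sqrt ((real m powr (\<beta> / 2) * G w) * real m powr (- \<beta> / 2))"
              using m by (simp add: powr_minus)
            also have "\<dots> \<le> (real m powr (\<beta> / 2) * G w + real m powr (- \<beta> / 2)) / 2"
              using G(3) by (intro arith_geo_mean_sqrt) auto
            finally show "sqrt (G w) \<le> (real m powr (\<beta> / 2) * G w + real m powr (- \<beta> / 2)) / 2" .
          qed (use C1 in auto)
          finally show "(\<integral>x. f (w(b := x)) \<partial>P)
            \<le> C1 * 4 powr \<beta> / 2 * (real m powr (\<beta> / 2) * G w + real m powr (- \<beta> / 2))"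
            by (simp only: times_divide_eq_right times_divide_eq_left mult.assoc)
        qed
        show "AE w in iid P. 0 \<le> C1 * 4 powr \<beta> / 2 * (real m powr (\<beta> / 2) * G w + real m powr (- \<beta> / 2))"
          using C1 G(3) by (intro AE_I2) auto
      qed
      also have "\<dots> = C1 * 4 powr \<beta> / 2 * (real m powr (\<beta> / 2) * (\<integral>w. G w \<partial>iid P) + real m powr (- \<beta> / 2))"
        using G(1) by (simp add: iid.prob_space)
      also have "\<dots> \<le> C1 * 4 powr \<beta> / 2 * (real m powr (\<beta> / 2) * e + real m powr (- \<beta> / 2))"
        using C1 G(2) by (intro mult_left_mono add_right_mono) auto
      also have "real m powr (\<beta> / 2) * e = (\<bar>C2\<bar> + 1) * real m powr (- \<beta> / 2)"
      proof -
        have "real m powr (\<beta> / 2) * real m powr (- \<beta>) = real m powr (- \<beta> / 2)"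
          by (simp add: powr_add[symmetric])
        then show ?thesis
          by (simp add: e_def mult_ac)
      qed
      finally show "(\<integral>w. \<bar>gap J a b w\<bar> \<partial>iid P) \<le> K * real m powr (- \<beta> / 2)"
        by (simp add: K_def algebra_simps)
    qed
  qed
qed

end

section \<open>The mean error of one statistic\<close>

text \<open>For m, n \<ge> 2 one has 1 / m \<le> q \<le> 1, so powers of q decrease in the exponent.
  The exponent in \<open>rate\<close> is the minimum of \<beta> and (2 + \<beta>) / 4, the latter
  being half of 1 + \<beta> / 2.\<close>

lemma rate_bounds:
  assumes \<beta>: "0 < \<beta>" and mn: "2 \<le> m" "2 \<le> n"
  defines "q \<equiv> real (m + n) / real (m * n)"
  shows "0 < rate \<beta> m n" "real m powr (- \<beta>) \<le> rate \<beta> m n"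
    "q * real m powr (- \<beta> / 2) \<le> (rate \<beta> m n)\<^sup>2" "real m powr (- 2 * \<beta>) \<le> (rate \<beta> m n)\<^sup>2"
proof -
  have q_eq: "q = 1 / real m + 1 / real n"
    using mn by (simp add: q_def field_simps)
  have "1 / real m \<le> 1 / 2" "1 / real n \<le> 1 / 2"
    using mn by (auto simp: field_simps)
  moreover have "0 < 1 / real m" "0 < 1 / real n"
    using mn by auto
  ultimately have q: "0 < q" "q \<le> 1" "1 / real m \<le> q"
    unfolding q_eq by linarith+
  have m_q: "real m powr (- p) \<le> q powr p" if "0 \<le> p" for p
  proof -
    have "real m powr (- p) = (1 / real m) powr p"
      by (simp add: powr_minus powr_divide inverse_eq_divide)
    also have "\<dots> \<le> q powr p"
      using q that by (intro powr_mono2) auto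
    finally show ?thesis .
  qed
  have anti: "q powr s \<le> q powr r" if "r \<le> s" for r s
    using q that by (intro powr_mono') auto
  have sq: "(q powr p)\<^sup>2 = q powr (2 * p)" for p
    using q by (simp add: powr_power)
  have rate: "rate \<beta> m n = q powr (if \<beta> \<le> 2/3 then \<beta> else (2 + \<beta>) / 4)"
    by (simp add: rate_def q_def)
  show "0 < rate \<beta> m n"
    using q by (simp add: rate)
  have "q powr \<beta> \<le> rate \<beta> m n"
    unfolding rate by (rule anti) auto
  then show "real m powr (- \<beta>) \<le> rate \<beta> m n"
    using m_q[of \<beta>] \<beta> by linarith
  have "q powr (2 * \<beta>) \<le> (rate \<beta> m n)\<^sup>2"
    unfolding rate sq by (rule anti) auto
  then show "real m powr (- 2 * \<beta>) \<le> (rate \<beta> m n)\<^sup>2"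
    using m_q[of "2 * \<beta>"] \<beta> by simp
  have "q * real m powr (- \<beta> / 2) \<le> q * q powr (\<beta> / 2)"
    using m_q[of "\<beta> / 2"] \<beta> q by (intro mult_left_mono) auto
  also have "\<dots> = q powr (1 + \<beta> / 2)"
    using q by (simp add: powr_add)
  also have "\<dots> \<le> (rate \<beta> m n)\<^sup>2"
    unfolding rate sq by (rule anti) auto
  finally show "q * real m powr (- \<beta> / 2) \<le> (rate \<beta> m n)\<^sup>2" .
qed

text \<open>In the expanded square, |A| |B|^2 quadruples have i = i', |A|^2 |B| have j = j', and
  there are (|A| |B|)^2 in all.\<close>

lemma (in prob_space) second_moment_grid:
  fixes f :: "'i \<Rightarrow> 'j \<Rightarrow> 'a \<Rightarrow> real"
  assumes fin: "finite A" "finite B"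
    and int: "\<And>i j i' j'. i \<in> A \<Longrightarrow> j \<in> B \<Longrightarrow> i' \<in> A \<Longrightarrow> j' \<in> B \<Longrightarrow>
      integrable M (\<lambda>x. f i j x * f i' j' x)"
    and diag: "\<And>i j i' j'. i \<in> A \<Longrightarrow> j \<in> B \<Longrightarrow> i' \<in> A \<Longrightarrow> j' \<in> B \<Longrightarrow> i = i' \<or> j = j' \<Longrightarrow>
      expectation (\<lambda>x. f i j x * f i' j' x) \<le> a"
    and off: "\<And>i j i' j'. i \<in> A \<Longrightarrow> j \<in> B \<Longrightarrow> i' \<in> A \<Longrightarrow> j' \<in> B \<Longrightarrow> i \<noteq> i' \<Longrightarrow> j \<noteq> j' \<Longrightarrow>
      expectation (\<lambda>x. f i j x * f i' j' x) \<le> b"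
    and nonneg: "0 \<le> a" "0 \<le> b"
  shows "expectation (\<lambda>x. (\<Sum>i\<in>A. \<Sum>j\<in>B. f i j x)\<^sup>2)
    \<le> real (card A) * real (card B) * ((real (card A) + real (card B)) * a + real (card A) * real (card B) * b)"
proof -
  have "(\<Sum>i\<in>A. \<Sum>j\<in>B. f i j x)\<^sup>2 = (\<Sum>i\<in>A. \<Sum>i'\<in>A. \<Sum>j\<in>B. \<Sum>j'\<in>B. f i j x * f i' j' x)" for x
    by (simp add: power2_eq_square sum_product)
  then have "expectation (\<lambda>x. (\<Sum>i\<in>A. \<Sum>j\<in>B. f i j x)\<^sup>2)
      = (\<Sum>i\<in>A. \<Sum>i'\<in>A. \<Sum>j\<in>B. \<Sum>j'\<in>B. expectation (\<lambda>x. f i j x * f i' j' x))"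
    using int by simp
  \<comment> \<open>Every quadruple receives \<open>b\<close>, and those with i = i' and j = j'
    receive \<open>a\<close> twice; the overcount is harmless because both bounds are
    nonnegative.\<close>
  also have "\<dots> \<le> (\<Sum>i\<in>A. \<Sum>i'\<in>A. \<Sum>j\<in>B. \<Sum>j'\<in>B. (of_bool (i = i') + of_bool (j = j')) * a + b)"
  proof (intro sum_mono)
    fix i j i' j' assume ij: "i \<in> A" "j \<in> B" "i' \<in> A" "j' \<in> B"
    consider "i = i' \<and> j = j'" | "i = i' \<and> j \<noteq> j'" | "i \<noteq> i' \<and> j = j'" | "i \<noteq> i' \<and> j \<noteq> j'"
      by blast
    then show "expectation (\<lambda>x. f i j x * f i' j' x) \<le> (of_bool (i = i') + of_bool (j = j')) * a + b"
      by cases (use diag[OF ij] off[OF ij] nonneg in auto)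
  qed
  also have "\<dots> = real (card A) * real (card B) * ((real (card A) + real (card B)) * a + real (card A) * real (card B) * b)"
    using fin
    by (simp add: distrib_right sum.distrib sum_distrib_right[symmetric] sum_distrib_left[symmetric]
        of_bool_def sum.delta)
  finally show ?thesis .
qed

section \<open>Means and covariances of the sign errors\<close>

context iid_depth
begin

lemma gap_reindex:
  assumes "inj \<sigma>" "finite I"
  shows "gap I a b (\<lambda>i. w (\<sigma> i)) = gap (\<sigma> ` I) (\<sigma> a) (\<sigma> b) w"
  using emp_reindex[of \<sigma> I S w] assms inj_on_subset[OF assms(1)] by (simp add: gap_def)

lemma gap_swap: "gap I b a w = - gap I a b w"
  unfolding gap_def
  using sgn_minus[of "D (w b) (emp S I w) - D (w a) (emp S I w)"] sgn_minus[of "D (w b) P - D (w a) P"]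
  by simp

lemma integrable_gap_mult:
  assumes "finite I" "I \<noteq> {}" "finite J" "J \<noteq> {}"
  shows "integrable (iid P) (\<lambda>w. gap I a b w * gap J a' b' w)"
proof (rule iid.integrable_const_bound[where B = 4])
  have "\<bar>gap I a b w * gap J a' b' w\<bar> \<le> 2 * 2" for w
    unfolding abs_mult by (intro mult_mono abs_gap_le) auto
  then show "AE w in iid P. norm (gap I a b w * gap J a' b' w) \<le> 4"
    by simp
  show "(\<lambda>w. gap I a b w * gap J a' b' w) \<in> borel_measurable (iid P)"
    using assms gap_measurable by (intro borel_measurable_times) auto
qed

text \<open>Exchanging the coordinates \<open>a\<close> and \<open>b\<close> preserves the law and the first factor but flips the sign of the second.\<close>
lemma integral_gap_mult_gap_eq_0:
  assumes I: "finite I" "I \<noteq> {}" "a \<notin> I" "b \<notin> I" and J: "finite J" "J \<noteq> {}" "a \<notin> J" "b \<notin> J"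
    and ab: "a' \<notin> {a, b}" "b' \<notin> {a, b}"
  shows "(\<integral>w. gap I a' b' w * gap J a b w \<partial>iid P) = 0"
proof -
  let ?t = "Transposition.transpose a b"
  have inj: "inj ?t"
    by simp
  have image: "?t ` K = K" if "a \<notin> K" "b \<notin> K" for K
  proof -
    have "?t i = i" if "i \<in> K" for i
      using that \<open>a \<notin> K\<close> \<open>b \<notin> K\<close> by (intro transpose_apply_other) auto
    then show ?thesis
      by simp
  qed
  have "gap I a' b' (\<lambda>i. w (?t i)) = gap I a' b' w" for w
    unfolding gap_reindex[OF inj I(1)] using image[OF I(3,4)] ab by simp
  moreover have "gap J a b (\<lambda>i. w (?t i)) = - gap J a b w" for w
    unfolding gap_reindex[OF inj J(1)] using image[OF J(3,4)] gap_swap[of J b a w] by simp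
  moreover have "(\<integral>w. gap I a' b' (\<lambda>i. w (?t i)) * gap J a b (\<lambda>i. w (?t i)) \<partial>iid P)
      = (\<integral>w. gap I a' b' w * gap J a b w \<partial>iid P)"
    by (rule integral_reindex[OF inj, where f = "\<lambda>w. gap I a' b' w * gap J a b w"])
      (intro borel_measurable_times gap_measurable I J)
  ultimately show ?thesis
    by simp
qed

text \<open>Each depth moves by at most \<open>c\<close>, so their difference moves by at most 2 c,
  which becomes the tolerance in \<open>close\<close>.\<close>

lemma abs_gap_diff_le:
  assumes "\<forall>x\<in>space S. \<bar>D x (emp S I w) - D x (emp S J w)\<bar> \<le> c" and "w \<in> space (iid P)"
  shows "\<bar>gap I a b w - gap J a b w\<bar> \<le> 2 * close J (2 * c) a b w"
proof -
  have "w a \<in> space S" "w b \<in> space S"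
    using assms(2) by (auto simp: space_iid)
  then have "\<bar>(D (w b) (emp S I w) - D (w a) (emp S I w)) - (D (w b) (emp S J w) - D (w a) (emp S J w))\<bar> \<le> 2 * c"
    using bspec[OF assms(1), of "w a"] bspec[OF assms(1), of "w b"] by linarith
  from abs_sgn_diff_le[OF this] show ?thesis
    by (simp add: gap_def close_def abs_minus_commute)
qed

text \<open>\<open>Asm4\<close> controls the second moment of \<open>close_prob\<close>, but its
  mean is wanted. The inequality 2 p \<le> s p^2 + 1 / s stands in for Cauchy-Schwarz; the later
  choice s = m^\<beta> gives both terms the order m^(-\<beta>).\<close>

lemma integral_abs_gap_diff_le:
  assumes J: "finite J" "J \<noteq> {}" "a \<notin> J" "b \<notin> J" "a \<noteq> b" and I: "finite I" "I \<noteq> {}"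
    and AE: "AE w in iid P. \<forall>x\<in>space S. \<bar>D x (emp S I w) - D x (emp S J w)\<bar> \<le> c"
    and s: "0 < s"
  shows "(\<integral>w. \<bar>gap I a b w - gap J a b w\<bar> \<partial>iid P) \<le> s * (\<integral>w. (close_prob J (2 * c) w)\<^sup>2 \<partial>iid P) + 1 / s"
proof -
  have int_gap: "integrable (iid P) (\<lambda>w. \<bar>gap I a b w - gap J a b w\<bar>)"
  proof (rule iid.integrable_const_bound[where B = 4])
    show "AE w in iid P. norm \<bar>gap I a b w - gap J a b w\<bar> \<le> 4"
    proof (rule AE_I2)
      fix w
      show "norm \<bar>gap I a b w - gap J a b w\<bar> \<le> 4"
        using abs_gap_le[of I a b w] abs_gap_le[of J a b w] unfolding real_norm_def by linarith
    qed
    show "(\<lambda>w. \<bar>gap I a b w - gap J a b w\<bar>) \<in> borel_measurable (iid P)"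
      using gap_measurable[OF I] gap_measurable[OF J(1,2)] by measurable
  qed
  have int_close: "integrable (iid P) (close J (2 * c) a b)"
    by (rule iid.integrable_const_bound[where B = 1]) (auto simp: abs_close_le close_measurable[OF J(1,2)])
  have int_prob: "integrable (iid P) (close_prob J (2 * c))"
    "integrable (iid P) (\<lambda>w. (close_prob J (2 * c) w)\<^sup>2)"
    using abs_close_prob_le[OF J(1,2)] close_prob_measurable[OF J(1,2)]
    by (auto intro!: iid.integrable_const_bound[where B = 1] simp: power_le_one abs_square_le_1)
  have "(\<integral>w. \<bar>gap I a b w - gap J a b w\<bar> \<partial>iid P) \<le> (\<integral>w. 2 * close J (2 * c) a b w \<partial>iid P)"
  proof (rule integral_mono_AE)
    show "AE w in iid P. \<bar>gap I a b w - gap J a b w\<bar> \<le> 2 * close J (2 * c) a b w"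
      using AE AE_space by eventually_elim (rule abs_gap_diff_le)
  qed (use int_gap int_close in auto)
  also have "\<dots> = (\<integral>w. 2 * close_prob J (2 * c) w \<partial>iid P)"
    using integral_close[OF J(1,2) J(5,3,4)] by simp
  also have "\<dots> \<le> (\<integral>w. s * (close_prob J (2 * c) w)\<^sup>2 + 1 / s \<partial>iid P)"
  proof (rule integral_mono)
    fix w
    have "0 \<le> (s * close_prob J (2 * c) w - 1)\<^sup>2 / s"
      using s by simp
    also have "\<dots> = s * (close_prob J (2 * c) w)\<^sup>2 + 1 / s - 2 * close_prob J (2 * c) w"
      using s by (simp add: power2_eq_square field_simps)
    finally show "2 * close_prob J (2 * c) w \<le> s * (close_prob J (2 * c) w)\<^sup>2 + 1 / s"
      by simp
  qed (use int_prob in auto)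
  also have "\<dots> = s * (\<integral>w. (close_prob J (2 * c) w)\<^sup>2 \<partial>iid P) + 1 / s"
    using int_prob by (simp add: iid.prob_space)
  finally show ?thesis .
qed

text \<open>
  By antisymmetry the three products in which at least one factor uses only the observations \<open>K\<close>
  have mean zero, so the covariance is that of the two perturbations.
\<close>
lemma integral_gap_mult_gap_le:
  assumes K: "finite K" "K \<noteq> {}" and ab: "distinct [a, b, a', b']" "{a, b, a', b'} \<inter> K = {}"
    and AE: "AE w in iid P. \<forall>x\<in>space S. \<bar>D x (emp S (insert a' K) w) - D x (emp S K w)\<bar> \<le> c"
      "AE w in iid P. \<forall>x\<in>space S. \<bar>D x (emp S (insert a K) w) - D x (emp S K w)\<bar> \<le> c"
  shows "(\<integral>w. gap (insert a' K) a b w * gap (insert a K) a' b' w \<partial>iid P)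
    \<le> 4 * (\<integral>w. (close_prob K (2 * c) w)\<^sup>2 \<partial>iid P)"
proof -
  let ?I = "insert a' K" and ?I' = "insert a K"
  have int: "integrable (iid P) (\<lambda>w. gap X a b w * gap Y a' b' w)"
    if "X \<in> {K, ?I}" "Y \<in> {K, ?I'}" for X Y
    using that K by (intro integrable_gap_mult) auto
  \<comment> \<open>For \<open>z1\<close> and \<open>z3\<close> the observations \<open>a'\<close>
    and \<open>b'\<close> are exchanged, for \<open>z2\<close> the observations \<open>a\<close> and
    \<open>b\<close>; each pair is absent from both empirical measures. The full product admits
    neither exchange, since \<open>a\<close> sits in \<open>?I'\<close> and \<open>a'\<close> in
    \<open>?I\<close>.\<close>
  have z1: "(\<integral>w. gap K a b w * gap ?I' a' b' w \<partial>iid P) = 0"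
    using K ab by (intro integral_gap_mult_gap_eq_0) auto
  have "(\<integral>w. gap K a' b' w * gap ?I a b w \<partial>iid P) = 0"
    using K ab by (intro integral_gap_mult_gap_eq_0) auto
  then have z2: "(\<integral>w. gap ?I a b w * gap K a' b' w \<partial>iid P) = 0"
    by (simp only: mult.commute)
  have z3: "(\<integral>w. gap K a b w * gap K a' b' w \<partial>iid P) = 0"
    using K ab by (intro integral_gap_mult_gap_eq_0) auto
  let ?d = "\<lambda>w. gap ?I a b w - gap K a b w" and ?d' = "\<lambda>w. gap ?I' a' b' w - gap K a' b' w"
  have exp: "?d w * ?d' w = gap ?I a b w * gap ?I' a' b' w - gap ?I a b w * gap K a' b' w
      - (gap K a b w * gap ?I' a' b' w - gap K a b w * gap K a' b' w)" for w
    by (simp add: algebra_simps)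
  have int_d: "integrable (iid P) (\<lambda>w. ?d w * ?d' w)"
    unfolding exp by (intro Bochner_Integration.integrable_diff int) auto
  have "(\<integral>w. ?d w * ?d' w \<partial>iid P) = (\<integral>w. gap ?I a b w * gap ?I' a' b' w \<partial>iid P)"
    unfolding exp using int z1 z2 z3 by simp
  moreover have "(\<integral>w. ?d w * ?d' w \<partial>iid P)
      \<le> (\<integral>w. 4 * (close K (2 * c) a b w * close K (2 * c) a' b' w) \<partial>iid P)"
  proof (rule integral_mono_AE[OF int_d])
    have "\<bar>close K (2 * c) a b w * close K (2 * c) a' b' w\<bar> \<le> 1" for w
      by (simp add: close_def)
    then show "integrable (iid P) (\<lambda>w. 4 * (close K (2 * c) a b w * close K (2 * c) a' b' w))"
      using close_measurable[OF K]
      by (intro integrable_mult_right iid.integrable_const_bound[where B = 1] borel_measurable_times) auto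
    show "AE w in iid P. ?d w * ?d' w \<le> 4 * (close K (2 * c) a b w * close K (2 * c) a' b' w)"
      using AE AE_space
    proof eventually_elim
      fix w
      assume "\<forall>x\<in>space S. \<bar>D x (emp S ?I w) - D x (emp S K w)\<bar> \<le> c"
        "\<forall>x\<in>space S. \<bar>D x (emp S ?I' w) - D x (emp S K w)\<bar> \<le> c" "w \<in> space (iid P)"
      then have "\<bar>?d w\<bar> * \<bar>?d' w\<bar> \<le> (2 * close K (2 * c) a b w) * (2 * close K (2 * c) a' b' w)"
        by (intro mult_mono abs_gap_diff_le) (auto simp: close_def)
      moreover have "?d w * ?d' w \<le> \<bar>?d w\<bar> * \<bar>?d' w\<bar>"
        unfolding abs_mult[symmetric] by (rule abs_ge_self)
      ultimately show "?d w * ?d' w \<le> 4 * (close K (2 * c) a b w * close K (2 * c) a' b' w)"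
        by linarith
    qed
  qed
  moreover have "(\<integral>w. close K (2 * c) a b w * close K (2 * c) a' b' w \<partial>iid P)
      = (\<integral>w. (close_prob K (2 * c) w)\<^sup>2 \<partial>iid P)"
    using K ab by (intro integral_close_mult_close) auto
  ultimately show ?thesis
    by simp
qed


lemma integrable_gap:
  assumes "finite I" "I \<noteq> {}"
  shows "integrable (iid P) (gap I a b)"
  by (rule iid.integrable_const_bound[where B = 2]) (auto simp: abs_gap_le gap_measurable[OF assms])

text \<open>The constant is uniform in \<open>n\<close>: the second sample, at the coordinates m +
  j, enters only through the compared observations, never through the empirical measure. Deletion is
  paid for in mean absolute value, and the deleted terms are estimated in mean square.\<close>

lemma integral_mean_gap:
  assumes asm: "Asm1 D P \<beta>" "Asm2 S D P \<beta>" "Asm3 S D P" "Asm4 S D P \<beta>" and \<beta>: "0 < \<beta>"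
  obtains K where "0 \<le> K"
    and "\<forall>\<^sub>F m in sequentially. \<forall>n\<ge>2.
      (\<integral>w. \<bar>1 / (2 * (real m * real n)) * (\<Sum>i=1..m. \<Sum>j=1..n. gap {1..m} i (m + j) w)\<bar> \<partial>iid P)
        \<le> K * rate \<beta> m n"
proof -
  obtain c where c: "0 < c" and pert: "\<forall>\<^sub>F m in sequentially. \<forall>I a. finite I \<longrightarrow> card I = m \<longrightarrow> a \<in> I \<longrightarrow>
      (AE w in iid P. \<forall>x\<in>space S. \<bar>D x (emp S I w) - D x (emp S (I - {a}) w)\<bar> \<le> c / real m)"
    by (rule depth_emp_perturb[OF asm(3)]) (rule that; assumption)
  have c2: "0 < 2 * c"
    using c by simp
  obtain K4 where K4: "0 \<le> K4" and sq: "\<forall>\<^sub>F m in sequentially. \<forall>I. finite I \<longrightarrow> Suc (card I) = m \<longrightarrow>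
      (\<integral>w. (close_prob I (2 * c / real m) w)\<^sup>2 \<partial>iid P) \<le> K4 * real m powr (- 2 * \<beta>)"
    by (rule integral_close_prob_square[OF asm(4) c2]) (rule that; assumption)
  obtain K2 where K2: "0 \<le> K2" and gap1: "\<forall>\<^sub>F m in sequentially. \<forall>J a b. finite J \<longrightarrow> card J = m \<longrightarrow>
      b \<notin> J \<longrightarrow> a \<noteq> b \<longrightarrow> (\<integral>w. \<bar>gap J a b w\<bar> \<partial>iid P) \<le> K2 * real m powr (- \<beta> / 2)"
    by (rule integral_gap[OF asm(1,2) \<beta>]) (rule that; assumption)
  \<comment> \<open>After one deletion the empirical measures have m - 1 points, so the bounds for
    sign errors and for a second deletion are taken at m - 1.\<close>
  note pred = eventually_compose_filterlim[OF _ filterlim_minus_const_nat_at_top]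
  define K2' where "K2' = 2 * (K2 * 2 powr (\<beta> / 2))"
  define K3 where "K3 = 4 * (K4 * 2 powr (2 * \<beta>))"
  have K23: "0 \<le> K2'" "0 \<le> K3"
    using K2 K4 by (simp_all add: K2'_def K3_def)
  \<comment> \<open>The first 1/2 is that of the normalisation 1 / (2 m n), whose square gives the
    two 1/4; the second 1/2 and the summand 1 beside the quarters come from AM-GM with the
    rate.\<close>
  define K where "K = (K4 + 1) / 2 + (K2' / 4 + K3 / 4 + 1) / 2"
  show ?thesis
  proof (rule that)
    show "0 \<le> K"
      using K4 K23 by (simp add: K_def)
    show "\<forall>\<^sub>F m in sequentially. \<forall>n\<ge>2.
      (\<integral>w. \<bar>1 / (2 * (real m * real n)) * (\<Sum>i=1..m. \<Sum>j=1..n. gap {1..m} i (m + j) w)\<bar> \<partial>iid P)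
        \<le> K * rate \<beta> m n"
      \<comment> \<open>The condition m \<ge> 3 leaves an observation after two deletions.\<close>
      using pert sq pred[OF pert] pred[OF sq] pred[OF gap1] eventually_ge_at_top[of 3]
    proof (eventually_elim, intro allI impI)
      fix m n :: nat
      assume pert: "\<forall>I a. finite I \<longrightarrow> card I = m \<longrightarrow> a \<in> I \<longrightarrow>
          (AE w in iid P. \<forall>x\<in>space S. \<bar>D x (emp S I w) - D x (emp S (I - {a}) w)\<bar> \<le> c / real m)"
        and sq: "\<forall>I. finite I \<longrightarrow> Suc (card I) = m \<longrightarrow>
          (\<integral>w. (close_prob I (2 * c / real m) w)\<^sup>2 \<partial>iid P) \<le> K4 * real m powr (- 2 * \<beta>)"
        and pert1: "\<forall>I a. finite I \<longrightarrow> card I = m - 1 \<longrightarrow> a \<in> I \<longrightarrow>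
          (AE w in iid P. \<forall>x\<in>space S. \<bar>D x (emp S I w) - D x (emp S (I - {a}) w)\<bar> \<le> c / real (m - 1))"
        and sq1: "\<forall>I. finite I \<longrightarrow> Suc (card I) = m - 1 \<longrightarrow>
          (\<integral>w. (close_prob I (2 * c / real (m - 1)) w)\<^sup>2 \<partial>iid P) \<le> K4 * real (m - 1) powr (- 2 * \<beta>)"
        and gap1: "\<forall>J a b. finite J \<longrightarrow> card J = m - 1 \<longrightarrow> b \<notin> J \<longrightarrow> a \<noteq> b \<longrightarrow>
          (\<integral>w. \<bar>gap J a b w\<bar> \<partial>iid P) \<le> K2 * real (m - 1) powr (- \<beta> / 2)"
        and m: "3 \<le> m" and n: "2 \<le> n"
      have m2: "2 \<le> m"
        using m by simp
      let ?I = "{1..m}" and ?N = "real m * real n" and ?\<delta> = "rate \<beta> m n"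
      define \<xi> where "\<xi> i j = gap ?I i (m + j)" for i j
      define \<eta> where "\<eta> i j = gap (?I - {i}) i (m + j)" for i j
      have ne: "?I \<noteq> {}" "?I - {i} \<noteq> {}" "?I - {i, i'} \<noteq> {}" for i i'
      proof -
        have "card (?I - {i, i'}) \<ge> m - 2"
          using diff_card_le_card_Diff[of "{i, i'}" ?I] card_insert_le_m1[of 2 "{i'}" i] by simp
        then have "?I - {i, i'} \<noteq> {}"
          using m by (metis card.empty diff_is_0_eq le_zero_eq not_less_eq_eq numeral_2_eq_2 numeral_3_eq_3)
        then show "?I \<noteq> {}" "?I - {i} \<noteq> {}" "?I - {i, i'} \<noteq> {}"
          by blast+
      qed
      have int_\<xi>: "integrable (iid P) (\<xi> i j)" and int_\<eta>: "integrable (iid P) (\<eta> i j)"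
        and int_\<eta>\<eta>: "integrable (iid P) (\<lambda>w. \<eta> i j w * \<eta> i' j' w)" for i j i' j'
        unfolding \<xi>_def \<eta>_def using ne(1,2) by (auto intro!: integrable_gap integrable_gap_mult)
      have diff: "(\<integral>w. \<bar>\<xi> i j w - \<eta> i j w\<bar> \<partial>iid P) \<le> (K4 + 1) * real m powr (- \<beta>)"
        if i: "i \<in> ?I" and j: "j \<in> {1..n}" for i j
      proof -
        have "(\<integral>w. \<bar>\<xi> i j w - \<eta> i j w\<bar> \<partial>iid P)
            \<le> real m powr \<beta> * (\<integral>w. (close_prob (?I - {i}) (2 * (c / real m)) w)\<^sup>2 \<partial>iid P) + 1 / real m powr \<beta>"
          unfolding \<xi>_def \<eta>_def
        proof (rule integral_abs_gap_diff_le)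
          show "AE w in iid P. \<forall>x\<in>space S. \<bar>D x (emp S ?I w) - D x (emp S (?I - {i}) w)\<bar> \<le> c / real m"
            using pert[rule_format, of ?I i] i by simp
        qed (use ne m i j in auto)
        also have "\<dots> \<le> real m powr \<beta> * (K4 * real m powr (- 2 * \<beta>)) + 1 / real m powr \<beta>"
          using sq[rule_format, of "?I - {i}"] i m by (intro add_right_mono mult_left_mono) simp_all
        also have "real m powr \<beta> * (K4 * real m powr (- 2 * \<beta>)) = K4 * real m powr (- \<beta>)"
        proof -
          have "real m powr \<beta> * real m powr (- 2 * \<beta>) = real m powr (- \<beta>)"
            by (simp add: powr_add[symmetric])
          then show ?thesis
            by (metis mult.left_commute)
        qed
        also have "1 / real m powr \<beta> = real m powr (- \<beta>)"
          by (simp add: powr_minus_divide)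
        finally show ?thesis
          by (simp add: distrib_right)
      qed
      have diag: "(\<integral>w. \<eta> i j w * \<eta> i' j' w \<partial>iid P) \<le> K2' * real m powr (- \<beta> / 2)"
        if i: "i \<in> ?I" and j: "j \<in> {1..n}" for i j i' j'
      proof -
        \<comment> \<open>No cancellation is used here: one factor is at most 2, the other is small
          in mean.\<close>
        have "(\<integral>w. \<eta> i j w * \<eta> i' j' w \<partial>iid P) \<le> (\<integral>w. 2 * \<bar>\<eta> i j w\<bar> \<partial>iid P)"
        proof (rule integral_mono[OF int_\<eta>\<eta>])
          fix w
          have "\<eta> i j w * \<eta> i' j' w \<le> \<bar>\<eta> i j w\<bar> * \<bar>\<eta> i' j' w\<bar>"
            unfolding abs_mult[symmetric] by (rule abs_ge_self)
          also have "\<dots> \<le> \<bar>\<eta> i j w\<bar> * 2"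
            unfolding \<eta>_def by (intro mult_left_mono abs_gap_le) simp
          finally show "\<eta> i j w * \<eta> i' j' w \<le> 2 * \<bar>\<eta> i j w\<bar>"
            by simp
        qed (use int_\<eta> in auto)
        also have "\<dots> = 2 * (\<integral>w. \<bar>\<eta> i j w\<bar> \<partial>iid P)"
          by simp
        also have "\<dots> \<le> 2 * (K2 * real (m - 1) powr (- \<beta> / 2))"
          unfolding \<eta>_def using i j gap1 by (intro mult_left_mono) simp_all
        also have "\<dots> \<le> 2 * (K2 * (2 powr (\<beta> / 2) * real m powr (- \<beta> / 2)))"
          using powr_minus_pred_le[OF m2, of "\<beta> / 2"] \<beta> K2 by (intro mult_left_mono) simp_all
        finally show ?thesis
          by (simp only: K2'_def mult.assoc)
      qed
      have off: "(\<integral>w. \<eta> i j w * \<eta> i' j' w \<partial>iid P) \<le> K3 * real m powr (- 2 * \<beta>)"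
        if i: "i \<in> ?I" "i' \<in> ?I" "i \<noteq> i'" and j: "j \<in> {1..n}" "j' \<in> {1..n}" "j \<noteq> j'" for i j i' j'
      proof -
        let ?K = "?I - {i, i'}"
        \<comment> \<open>Each deleted sample is the common core \<open>?K\<close> with the
          observation deleted from the other one added back. The core is one observation short of m
          - 1, the size at which \<open>sq1\<close> applies.\<close>
        have ins: "?I - {i} = insert i' ?K" "?I - {i'} = insert i ?K"
          using i by auto
        have diffs: "?I - {i} - {i'} = ?K" "?I - {i'} - {i} = ?K"
          by auto
        have card: "card (?I - {i}) = m - 1" "card (?I - {i'}) = m - 1" "Suc (card ?K) = m - 1"
          using i m by (auto simp: card_Diff_subset)
        have AE1: "AE w in iid P. \<forall>x\<in>space S. \<bar>D x (emp S (insert i' ?K) w) - D x (emp S ?K w)\<bar> \<le> c / real (m - 1)"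
          using pert1[rule_format, of "?I - {i}" i'] card(1) i unfolding diffs ins(1) by simp
        have AE2: "AE w in iid P. \<forall>x\<in>space S. \<bar>D x (emp S (insert i ?K) w) - D x (emp S ?K w)\<bar> \<le> c / real (m - 1)"
          using pert1[rule_format, of "?I - {i'}" i] card(2) i unfolding diffs ins(2) by simp
        have "(\<integral>w. \<eta> i j w * \<eta> i' j' w \<partial>iid P)
            \<le> 4 * (\<integral>w. (close_prob ?K (2 * (c / real (m - 1))) w)\<^sup>2 \<partial>iid P)"
          unfolding \<eta>_def ins
          by (rule integral_gap_mult_gap_le[OF _ ne(3) _ _ AE1 AE2]) (use i j in auto)
        also have "\<dots> \<le> 4 * (K4 * real (m - 1) powr (- 2 * \<beta>))"
          using sq1[rule_format, of ?K] card(3) by (intro mult_left_mono) simp_all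
        also have "\<dots> \<le> 4 * (K4 * (2 powr (2 * \<beta>) * real m powr (- 2 * \<beta>)))"
          using powr_minus_pred_le[OF m2, of "2 * \<beta>"] \<beta> K4 by (intro mult_left_mono) simp_all
        finally show ?thesis
          by (simp only: K3_def mult.assoc)
      qed
      have N: "0 < ?N"
        using m n by simp
      define \<alpha> where "\<alpha> w = 1 / (2 * ?N) * (\<Sum>i\<in>?I. \<Sum>j\<in>{1..n}. \<eta> i j w)" for w
      define \<alpha>' where "\<alpha>' w = 1 / (2 * ?N) * (\<Sum>i\<in>?I. \<Sum>j\<in>{1..n}. \<xi> i j w)" for w
      have int_\<alpha>: "integrable (iid P) \<alpha>" "integrable (iid P) \<alpha>'"
        unfolding \<alpha>_def \<alpha>'_def using int_\<xi> int_\<eta> by auto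
      have "(\<Sum>i\<in>?I. \<Sum>j\<in>{1..n}. \<eta> i j w)\<^sup>2
          = (\<Sum>i\<in>?I. \<Sum>i'\<in>?I. \<Sum>j\<in>{1..n}. \<Sum>j'\<in>{1..n}. \<eta> i j w * \<eta> i' j' w)" for w
        by (simp add: power2_eq_square sum_product)
      then have int_\<alpha>2: "integrable (iid P) (\<lambda>w. (\<alpha> w)\<^sup>2)"
        unfolding \<alpha>_def power_mult_distrib using int_\<eta>\<eta> by simp
      have rb: "0 < ?\<delta>" "real m powr (- \<beta>) \<le> ?\<delta>"
        "real (m + n) / real (m * n) * real m powr (- \<beta> / 2) \<le> ?\<delta>\<^sup>2" "real m powr (- 2 * \<beta>) \<le> ?\<delta>\<^sup>2"
        using rate_bounds[OF \<beta> m2 n] by blast+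
      have "(\<integral>w. \<bar>\<alpha>' w - \<alpha> w\<bar> \<partial>iid P) \<le> (K4 + 1) / 2 * ?\<delta>"
      proof -
        have "(\<integral>w. \<bar>\<alpha>' w - \<alpha> w\<bar> \<partial>iid P)
            \<le> (\<integral>w. 1 / (2 * ?N) * (\<Sum>i\<in>?I. \<Sum>j\<in>{1..n}. \<bar>\<xi> i j w - \<eta> i j w\<bar>) \<partial>iid P)"
        proof (rule integral_mono)
          fix w
          have "\<bar>\<alpha>' w - \<alpha> w\<bar> = 1 / (2 * ?N) * \<bar>\<Sum>i\<in>?I. \<Sum>j\<in>{1..n}. \<xi> i j w - \<eta> i j w\<bar>"
            unfolding \<alpha>_def \<alpha>'_def sum_subtractf right_diff_distrib[symmetric] abs_mult using N by simp
          also have "\<dots> \<le> 1 / (2 * ?N) * (\<Sum>i\<in>?I. \<Sum>j\<in>{1..n}. \<bar>\<xi> i j w - \<eta> i j w\<bar>)"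
            using N by (intro mult_left_mono order_trans[OF sum_abs] sum_mono sum_abs) auto
          finally show "\<bar>\<alpha>' w - \<alpha> w\<bar> \<le> 1 / (2 * ?N) * (\<Sum>i\<in>?I. \<Sum>j\<in>{1..n}. \<bar>\<xi> i j w - \<eta> i j w\<bar>)" .
        qed (use int_\<alpha> int_\<xi> int_\<eta> in auto)
        also have "\<dots> = 1 / (2 * ?N) * (\<Sum>i\<in>?I. \<Sum>j\<in>{1..n}. \<integral>w. \<bar>\<xi> i j w - \<eta> i j w\<bar> \<partial>iid P)"
          using int_\<xi> int_\<eta> by simp
        also have "\<dots> \<le> 1 / (2 * ?N) * (\<Sum>i\<in>?I. \<Sum>j\<in>{1..n}. (K4 + 1) * real m powr (- \<beta>))"
          using N by (intro mult_left_mono sum_mono diff) auto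
        also have "\<dots> = (K4 + 1) / 2 * real m powr (- \<beta>)"
          using m n by simp
        also have "\<dots> \<le> (K4 + 1) / 2 * ?\<delta>"
          using rb(2) K4 by (intro mult_left_mono) auto
        finally show ?thesis .
      qed
      moreover have "(\<integral>w. \<bar>\<alpha> w\<bar> \<partial>iid P) \<le> (K2' / 4 + K3 / 4 + 1) / 2 * ?\<delta>"
      proof -
        have "(\<integral>w. (\<Sum>i\<in>?I. \<Sum>j\<in>{1..n}. \<eta> i j w)\<^sup>2 \<partial>iid P)
            \<le> real (card ?I) * real (card {1..n}) * ((real (card ?I) + real (card {1..n})) * (K2' * real m powr (- \<beta> / 2))
              + real (card ?I) * real (card {1..n}) * (K3 * real m powr (- 2 * \<beta>)))"
          by (rule iid.second_moment_grid) (use int_\<eta>\<eta> diag off K23 in auto)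
        then have "(\<integral>w. (\<Sum>i\<in>?I. \<Sum>j\<in>{1..n}. \<eta> i j w)\<^sup>2 \<partial>iid P)
            \<le> ?N * (real (m + n) * (K2' * real m powr (- \<beta> / 2)) + ?N * (K3 * real m powr (- 2 * \<beta>)))"
          by simp
        then have "(1 / (2 * ?N))\<^sup>2 * (\<integral>w. (\<Sum>i\<in>?I. \<Sum>j\<in>{1..n}. \<eta> i j w)\<^sup>2 \<partial>iid P)
            \<le> (1 / (2 * ?N))\<^sup>2 * (?N * (real (m + n) * (K2' * real m powr (- \<beta> / 2)) + ?N * (K3 * real m powr (- 2 * \<beta>))))"
          by (rule mult_left_mono) simp
        also have "\<dots> = K2' / 4 * (real (m + n) / real (m * n) * real m powr (- \<beta> / 2)) + K3 / 4 * real m powr (- 2 * \<beta>)"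
          using m n by (simp add: power2_eq_square field_simps)
        also have "\<dots> \<le> K2' / 4 * ?\<delta>\<^sup>2 + K3 / 4 * ?\<delta>\<^sup>2"
          using rb(3,4) K23 by (intro add_mono mult_left_mono) auto
        finally have sq_le: "(\<integral>w. (\<alpha> w)\<^sup>2 \<partial>iid P) \<le> (K2' / 4 + K3 / 4) * ?\<delta>\<^sup>2"
          by (simp only: \<alpha>_def power_mult_distrib integral_mult_right_zero distrib_right)
        \<comment> \<open>AM-GM at the scale of the rate turns a second moment of order \<delta>^2
          into a mean of order \<delta>.\<close>
        have "(\<integral>w. \<bar>\<alpha> w\<bar> \<partial>iid P) \<le> (\<integral>w. ((\<alpha> w)\<^sup>2 / ?\<delta> + ?\<delta>) / 2 \<partial>iid P)"
        proof (rule integral_mono)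
          fix w
          have "0 \<le> (\<bar>\<alpha> w\<bar> - ?\<delta>)\<^sup>2 / (2 * ?\<delta>)"
            using rb(1) by simp
          also have "\<dots> = ((\<alpha> w)\<^sup>2 / ?\<delta> + ?\<delta>) / 2 - \<bar>\<alpha> w\<bar>"
            using rb(1) by (simp add: power2_diff field_simps power2_eq_square)
          finally show "\<bar>\<alpha> w\<bar> \<le> ((\<alpha> w)\<^sup>2 / ?\<delta> + ?\<delta>) / 2"
            by simp
        qed (use int_\<alpha> int_\<alpha>2 in auto)
        also have "\<dots> = ((\<integral>w. (\<alpha> w)\<^sup>2 \<partial>iid P) / ?\<delta> + ?\<delta>) / 2"
          using int_\<alpha>2 by (simp add: iid.prob_space)
        also have "\<dots> \<le> ((K2' / 4 + K3 / 4) * ?\<delta>\<^sup>2 / ?\<delta> + ?\<delta>) / 2"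
          using sq_le rb(1) by (intro divide_right_mono add_right_mono) auto
        also have "\<dots> = (K2' / 4 + K3 / 4 + 1) / 2 * ?\<delta>"
          using rb(1) by (simp add: power2_eq_square field_simps)
        finally show ?thesis .
      qed
      moreover have "(\<integral>w. \<bar>\<alpha>' w\<bar> \<partial>iid P) \<le> (\<integral>w. \<bar>\<alpha>' w - \<alpha> w\<bar> + \<bar>\<alpha> w\<bar> \<partial>iid P)"
        using int_\<alpha> by (intro integral_mono) auto
      moreover have "\<dots> = (\<integral>w. \<bar>\<alpha>' w - \<alpha> w\<bar> \<partial>iid P) + (\<integral>w. \<bar>\<alpha> w\<bar> \<partial>iid P)"
        using int_\<alpha> by simp
      ultimately have "(\<integral>w. \<bar>\<alpha>' w\<bar> \<partial>iid P) \<le> K * ?\<delta>"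
        by (simp only: K_def distrib_right)
      then show "(\<integral>w. \<bar>1 / (2 * (real m * real n)) * (\<Sum>i=1..m. \<Sum>j=1..n. gap {1..m} i (m + j) w)\<bar> \<partial>iid P)
          \<le> K * rate \<beta> m n"
        by (simp only: \<alpha>'_def \<xi>_def)
    qed
  qed
qed

end

section \<open>Two samples\<close>

text \<open>The indicator of s < t plus half the indicator of s = t is (1 + sgn (t - s)) /
  2.\<close>

lemma LS_eq_sgn:
  assumes "1 \<le> m" "1 \<le> n"
  shows "LS S D m x n y = 1 / 2 + 1 / (2 * (real m * real n)) *
    (\<Sum>i=1..m. \<Sum>j=1..n. sgn (D (y j) (emp S {1..m} x) - D (x i) (emp S {1..m} x)))"
proof -
  have "of_bool (s < t) + 1/2 * of_bool (s = t) = 1/2 + 1/2 * sgn (t - s)" for s t :: real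
    by (auto simp: sgn_if)
  then have "LS S D m x n y = 1 / (real m * real n) *
      (\<Sum>i=1..m. \<Sum>j=1..n. 1/2 + 1/2 * sgn (D (y j) (emp S {1..m} x) - D (x i) (emp S {1..m} x)))"
    unfolding LS_def by simp
  also have "\<dots> = 1 / (real m * real n) * (real m * real n / 2 + 1/2 *
      (\<Sum>i=1..m. \<Sum>j=1..n. sgn (D (y j) (emp S {1..m} x) - D (x i) (emp S {1..m} x))))"
    unfolding sum.distrib sum_distrib_left[symmetric] by simp
  also have "\<dots> = 1 / 2 + 1 / (2 * (real m * real n)) *
    (\<Sum>i=1..m. \<Sum>j=1..n. sgn (D (y j) (emp S {1..m} x) - D (x i) (emp S {1..m} x)))"
    using assms by (simp add: field_simps)
  finally show ?thesis .
qed

text \<open>This is Markov's inequality at level L \<delta>.\<close>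

lemma (in prob_space) big_OP_expectation:
  assumes meas: "\<And>k. Z k \<in> borel_measurable M"
    and bound: "\<forall>\<^sub>F k in sequentially. 0 < \<delta> k \<and> integrable M (Z k) \<and> expectation (\<lambda>x. \<bar>Z k x\<bar>) \<le> K * \<delta> k"
  shows "big_OP M Z \<delta>"
  unfolding big_OP_def
proof (intro conjI allI impI meas)
  fix \<epsilon> :: real assume \<epsilon>: "0 < \<epsilon>"
  \<comment> \<open>The added 1 keeps \<open>L\<close> positive when \<open>K\<close> = 0 and makes
    K / L < \<epsilon> strict.\<close>
  define L where "L = (\<bar>K\<bar> + 1) / \<epsilon>"
  have L: "0 < L"
    using \<epsilon> by (simp add: L_def)
  have "\<forall>\<^sub>F k in sequentially. prob {x \<in> space M. \<bar>Z k x / \<delta> k\<bar> > L} < \<epsilon>"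
    using bound
  proof eventually_elim
    fix k assume k: "0 < \<delta> k \<and> integrable M (Z k) \<and> expectation (\<lambda>x. \<bar>Z k x\<bar>) \<le> K * \<delta> k"
    note [measurable] = meas[of k]
    have "prob {x \<in> space M. \<bar>Z k x / \<delta> k\<bar> > L} \<le> prob {x \<in> space M. L * \<delta> k \<le> \<bar>Z k x\<bar>}"
    proof (rule finite_measure_mono)
      show "{x \<in> space M. \<bar>Z k x / \<delta> k\<bar> > L} \<subseteq> {x \<in> space M. L * \<delta> k \<le> \<bar>Z k x\<bar>}"
        using k by (auto simp: field_simps)
    qed measurable
    also have "\<dots> \<le> expectation (\<lambda>x. \<bar>Z k x\<bar>) / (L * \<delta> k)"
      using k L by (intro integral_Markov_inequality_measure[where A = "{}"]) auto
    also have "\<dots> \<le> K * \<delta> k / (L * \<delta> k)"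
      using k L by (intro divide_right_mono) auto
    also have "\<dots> = K / L"
      using k by simp
    also have "\<dots> < \<epsilon>"
    proof -
      have "\<epsilon> * L = \<bar>K\<bar> + 1"
        using \<epsilon> by (simp add: L_def)
      then have "K < \<epsilon> * L"
        by linarith
      then show ?thesis
        using L by (simp add: pos_divide_less_eq)
    qed
    finally show "prob {x \<in> space M. \<bar>Z k x / \<delta> k\<bar> > L} < \<epsilon>" .
  qed
  then show "\<exists>K. \<forall>\<^sub>F k in sequentially. prob {x \<in> space M. \<bar>Z k x / \<delta> k\<bar> > K} < \<epsilon>" ..
qed

section \<open>Two samples with a common law, pooled into one sequence\<close>

locale two_sample = iid_depth S P D + M: prob_space M
  for S P :: "'a measure" and D :: "'a \<Rightarrow> 'a measure \<Rightarrow> real" and M :: "'w measure" +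
  fixes X Y :: "nat \<Rightarrow> 'w \<Rightarrow> 'a"
  assumes X_measurable [measurable]: "\<And>i. X i \<in> M \<rightarrow>\<^sub>M S"
    and Y_measurable [measurable]: "\<And>j. Y j \<in> M \<rightarrow>\<^sub>M S"
    and joint_law: "distr M (PiM UNIV (\<lambda>_. S)) (\<lambda>\<omega> k. case_sum X Y k \<omega>) = PiM UNIV (\<lambda>_. P)"
begin

text \<open>The index type is left free for two uses: nat + nat into itself exchanges the samples,
  nat into nat + nat pools them.\<close>

lemma joint_law_reindex:
  fixes \<sigma> :: "'k \<Rightarrow> nat + nat"
  assumes "inj \<sigma>"
  shows "distr M (PiM UNIV (\<lambda>_. S)) (\<lambda>\<omega> k. case_sum X Y (\<sigma> k) \<omega>) = PiM UNIV (\<lambda>_. P)"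
proof -
  let ?Z = "\<lambda>\<omega> k. case_sum X Y k \<omega>" and ?U = "UNIV :: (nat + nat) set" and ?K = "UNIV :: 'k set"
  have rv: "case_sum X Y k \<in> M \<rightarrow>\<^sub>M S" for k
    using X_measurable Y_measurable by (cases k) (simp_all only: sum.case)
  have Z_meas: "?Z \<in> M \<rightarrow>\<^sub>M PiM ?U (\<lambda>_. S)"
  proof (rule measurable_PiM_single')
    show "(\<lambda>\<omega>. case_sum X Y k \<omega>) \<in> M \<rightarrow>\<^sub>M S" for k
      by (rule rv)
    show "?Z \<in> space M \<rightarrow> (\<Pi>\<^sub>E k\<in>?U. space S)"
      using measurable_space[OF rv] by (simp add: PiE_def Pi_def)
  qed
  define r where "r z k = z (\<sigma> k)" for z :: "nat + nat \<Rightarrow> 'a" and k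
  have r_meas: "r \<in> PiM ?U (\<lambda>_. S) \<rightarrow>\<^sub>M PiM ?K (\<lambda>_. S)"
  proof (rule measurable_PiM_single')
    show "(\<lambda>z. r z k) \<in> PiM ?U (\<lambda>_. S) \<rightarrow>\<^sub>M S" for k
      unfolding r_def by (rule measurable_component_singleton) simp
    show "r \<in> space (PiM ?U (\<lambda>_. S)) \<rightarrow> (\<Pi>\<^sub>E k\<in>?K. space S)"
      by (simp add: r_def space_PiM PiE_def Pi_def)
  qed
  have "distr (distr M (PiM ?U (\<lambda>_. S)) ?Z) (PiM ?K (\<lambda>_. S)) r = distr M (PiM ?K (\<lambda>_. S)) (r \<circ> ?Z)"
    by (rule distr_distr[OF r_meas Z_meas])
  moreover have "r \<circ> ?Z = (\<lambda>\<omega> k. case_sum X Y (\<sigma> k) \<omega>)"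
    by (simp add: fun_eq_iff r_def)
  ultimately have "distr M (PiM ?K (\<lambda>_. S)) (\<lambda>\<omega> k. case_sum X Y (\<sigma> k) \<omega>)
      = distr (distr M (PiM ?U (\<lambda>_. S)) ?Z) (PiM ?K (\<lambda>_. S)) r"
    by (simp only:)
  also have "\<dots> = distr (PiM ?U (\<lambda>_. P)) (PiM ?K (\<lambda>_. P)) r"
    unfolding joint_law by (rule distr_cong) (simp_all cong: sets_PiM_cong)
  also have "\<dots> = PiM ?K (\<lambda>_. P)"
    using distr_PiM_reindex[of ?U "\<lambda>_. P" \<sigma> ?K] assms P.prob_space_axioms
    by (simp add: restrict_UNIV r_def[abs_def])
  finally show ?thesis .
qed

lemma swap: "two_sample S P D M Y X"
proof
  let ?\<sigma> = "case_sum Inr Inl :: nat + nat \<Rightarrow> nat + nat"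
  have "case_sum Y X k = case_sum X Y (?\<sigma> k)" for k
    by (cases k) simp_all
  moreover have "inj ?\<sigma>"
    by (auto simp: inj_def split: sum.splits)
  ultimately show "distr M (PiM UNIV (\<lambda>_. S)) (\<lambda>\<omega> k. case_sum Y X k \<omega>) = PiM UNIV (\<lambda>_. P)"
    using joint_law_reindex[of ?\<sigma>] by simp
qed (rule X_measurable Y_measurable)+

text \<open>Coordinate m + j is the j-th observation of the second sample. Coordinate 0 holds
  \<open>X 0\<close>, so that the pooled sequence is an injective reindexing of the joint
  family.\<close>

definition pooled :: "nat \<Rightarrow> 'w \<Rightarrow> nat \<Rightarrow> 'a" where
  "pooled m \<omega> k = (if k \<le> m then X k \<omega> else Y (k - m) \<omega>)"

lemma pooled_measurable: "pooled m \<in> M \<rightarrow>\<^sub>M iid P"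
proof -
  have "pooled m \<in> M \<rightarrow>\<^sub>M PiM UNIV (\<lambda>_. S)"
  proof (rule measurable_PiM_single')
    fix k
    show "(\<lambda>\<omega>. pooled m \<omega> k) \<in> M \<rightarrow>\<^sub>M S"
      unfolding pooled_def by simp
  qed (use measurable_space[OF X_measurable] measurable_space[OF Y_measurable] in \<open>auto simp: pooled_def\<close>)
  then show ?thesis
    using measurable_cong_sets[OF refl sets_iid] by blast
qed

lemma distr_pooled: "distr M (iid P) (pooled m) = iid P"
proof -
  define \<sigma> :: "nat \<Rightarrow> nat + nat" where "\<sigma> k = (if k \<le> m then Inl k else Inr (k - m))" for k
  have "inj \<sigma>"
    by (auto simp: inj_def \<sigma>_def split: if_splits)
  moreover have "pooled m = (\<lambda>\<omega> k. case_sum X Y (\<sigma> k) \<omega>)"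
    by (auto simp: fun_eq_iff pooled_def \<sigma>_def)
  ultimately have "distr M (PiM UNIV (\<lambda>_. S)) (pooled m) = iid P"
    using joint_law_reindex[of \<sigma>] by (simp add: iid_def)
  then show ?thesis
    using distr_cong[of M M "PiM UNIV (\<lambda>_. S)" "iid P" "pooled m" "pooled m"] sets_iid by simp
qed

text \<open>The subtracted average of true-depth signs is odd under exchange of the two samples, so
  it disappears from the sum of the two statistics and never has to be estimated.\<close>

definition dev :: "nat \<Rightarrow> nat \<Rightarrow> 'w \<Rightarrow> real" where
  "dev m n \<omega> = LS S D m (\<lambda>i. X i \<omega>) n (\<lambda>j. Y j \<omega>) - 1 / 2
     - 1 / (2 * (real m * real n)) * (\<Sum>i=1..m. \<Sum>j=1..n. sgn (D (Y j \<omega>) P - D (X i \<omega>) P))"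

lemma dev_eq:
  assumes "1 \<le> m" "1 \<le> n"
  shows "dev m n \<omega> = 1 / (2 * (real m * real n)) *
    (\<Sum>i=1..m. \<Sum>j=1..n. gap {1..m} i (m + j) (pooled m \<omega>))"
proof -
  have "emp S {1..m} (pooled m \<omega>) = emp S {1..m} (\<lambda>i. X i \<omega>)"
    by (intro emp_cong) (simp add: pooled_def)
  then have "(\<Sum>i=1..m. \<Sum>j=1..n. gap {1..m} i (m + j) (pooled m \<omega>)) = (\<Sum>i=1..m. \<Sum>j=1..n.
      sgn (D (Y j \<omega>) (emp S {1..m} (\<lambda>i. X i \<omega>)) - D (X i \<omega>) (emp S {1..m} (\<lambda>i. X i \<omega>)))
      - sgn (D (Y j \<omega>) P - D (X i \<omega>) P))"
    by (intro sum.cong) (simp_all add: gap_def pooled_def)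
  then show ?thesis
    by (simp only: dev_def LS_eq_sgn[OF assms] sum_subtractf right_diff_distrib)
qed

lemma
  assumes m: "1 \<le> m" and n: "1 \<le> n"
  shows integrable_dev: "integrable M (dev m n)"
    and integral_abs_dev: "(\<integral>\<omega>. \<bar>dev m n \<omega>\<bar> \<partial>M) = (\<integral>w. \<bar>1 / (2 * (real m * real n)) *
      (\<Sum>i=1..m. \<Sum>j=1..n. gap {1..m} i (m + j) w)\<bar> \<partial>iid P)"
proof -
  define f where "f w = 1 / (2 * (real m * real n)) * (\<Sum>i=1..m. \<Sum>j=1..n. gap {1..m} i (m + j) w)" for w
  have f: "integrable (iid P) f"
    unfolding f_def using m
    by (intro integrable_mult_right Bochner_Integration.integrable_sum integrable_gap) auto
  have dev: "dev m n = (\<lambda>\<omega>. f (pooled m \<omega>))"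
    unfolding f_def using dev_eq[OF m n] by auto
  have "integrable (distr M (iid P) (pooled m)) f"
    unfolding distr_pooled by (rule f)
  then show "integrable M (dev m n)"
    unfolding dev by (rule integrable_distr[OF pooled_measurable])
  have "(\<integral>\<omega>. \<bar>f (pooled m \<omega>)\<bar> \<partial>M) = (\<integral>w. \<bar>f w\<bar> \<partial>distr M (iid P) (pooled m))"
    using f by (intro integral_distr[symmetric] pooled_measurable) auto
  then show "(\<integral>\<omega>. \<bar>dev m n \<omega>\<bar> \<partial>M) = (\<integral>w. \<bar>1 / (2 * (real m * real n)) *
      (\<Sum>i=1..m. \<Sum>j=1..n. gap {1..m} i (m + j) w)\<bar> \<partial>iid P)"
    unfolding distr_pooled dev f_def .
qed

lemma LS_measurable: "(\<lambda>\<omega>. LS S D m (\<lambda>i. X i \<omega>) n (\<lambda>j. Y j \<omega>)) \<in> borel_measurable M"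
proof -
  have X: "(\<lambda>\<omega> i. X i \<omega>) \<in> M \<rightarrow>\<^sub>M PiM UNIV (\<lambda>_. S)"
    by (rule measurable_PiM_single') (use measurable_space[OF X_measurable] in auto)
  have "(\<lambda>\<omega>. of_bool (D (X i \<omega>) (emp S {1..m} (\<lambda>i. X i \<omega>)) < D (Y j \<omega>) (emp S {1..m} (\<lambda>i. X i \<omega>)))
      + 1 / 2 * of_bool (D (X i \<omega>) (emp S {1..m} (\<lambda>i. X i \<omega>)) = D (Y j \<omega>) (emp S {1..m} (\<lambda>i. X i \<omega>))) :: real)
      \<in> borel_measurable M" if "i \<in> {1..m}" for i j
  proof -
    have I: "finite {1..m}" "{1..m} \<noteq> {}" "{1..m} \<subseteq> UNIV"
      using that by auto
    note [measurable] = depth_emp_measurable[OF X_measurable X I] depth_emp_measurable[OF Y_measurable X I]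
    show ?thesis
      unfolding of_bool_def by measurable
  qed
  then show ?thesis
    unfolding LS_def by (intro borel_measurable_times borel_measurable_sum borel_measurable_const)
qed

end

theorem corollary2p5:
  fixes S P Q :: "'a measure"
    and D :: "'a \<Rightarrow> 'a measure \<Rightarrow> real"
    and M :: "'w measure"
    and X Y :: "nat \<Rightarrow> 'w \<Rightarrow> 'a"
    and \<beta> \<tau> :: real
    and m n :: "nat \<Rightarrow> nat"
  assumes "depth_function S D"
    and "P \<in> space (prob_algebra S)" and "Q \<in> space (prob_algebra S)"
    and "prob_space M"
    and "prob_space.indep_vars M (\<lambda>_. S) (case_sum X Y) UNIV"
    and "\<And>i. distr M S (X i) = P"
    and "\<And>j. distr M S (Y j) = Q"
    and "1/2 < \<beta>" and "\<beta> \<le> 1"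
    and "Asm1 D P \<beta>" and "Asm2 S D P \<beta>" and "Asm3 S D P" and "Asm4 S D P \<beta>"
    and "P = Q"
    and "filterlim m at_top sequentially" and "filterlim n at_top sequentially"
    and "0 < \<tau>" and "\<tau> < 1"
    and "(\<lambda>k. real (m k) / real (m k + n k)) \<longlonglongrightarrow> \<tau>"
  shows "big_OP M
           (\<lambda>k \<omega>. LS S D (m k) (\<lambda>i. X i \<omega>) (n k) (\<lambda>j. Y j \<omega>)
                   + LS S D (n k) (\<lambda>j. Y j \<omega>) (m k) (\<lambda>i. X i \<omega>) - 1)
           (\<lambda>k. rate \<beta> (m k) (n k))
       \<and> (\<beta> = 1 \<longrightarrow>
           big_OP M
             (\<lambda>k \<omega>. LS S D (m k) (\<lambda>i. X i \<omega>) (n k) (\<lambda>j. Y j \<omega>)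
                     + LS S D (n k) (\<lambda>j. Y j \<omega>) (m k) (\<lambda>i. X i \<omega>) - 1)
             (\<lambda>k. (real (m k + n k) / real (m k * n k)) powr (3/4)))"
proof -
  interpret M: prob_space M
    by (rule assms(4))
  have indep: "M.indep_vars (\<lambda>_. S) (case_sum X Y) UNIV"
    by (rule assms(5))
  interpret XY: two_sample S P D M X Y
  proof
    have rv: "case_sum X Y k \<in> M \<rightarrow>\<^sub>M S" for k
      using indep by (simp add: M.indep_vars_def2)
    from rv[of "Inl i" for i] rv[of "Inr j" for j]
    show "X i \<in> M \<rightarrow>\<^sub>M S" "Y i \<in> M \<rightarrow>\<^sub>M S" for i
      by simp_all
    \<comment> \<open>The null hypothesis enters here: all components of the joint family share one
      law.\<close>
    have "distr M S (case_sum X Y k) = P" for k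
      by (cases k) (simp_all add: assms(6,7,14))
    then show "distr M (PiM UNIV (\<lambda>_. S)) (\<lambda>\<omega> k. case_sum X Y k \<omega>) = PiM UNIV (\<lambda>_. P)"
      using M.indep_vars_iff_distr_eq_PiM[of UNIV "case_sum X Y" "\<lambda>_. S"] rv indep
      by (simp add: restrict_UNIV)
  qed (rule assms(1,2))+
  interpret YX: two_sample S P D M Y X
    by (rule XY.swap)
  define Z where "Z k \<omega> = LS S D (m k) (\<lambda>i. X i \<omega>) (n k) (\<lambda>j. Y j \<omega>)
      + LS S D (n k) (\<lambda>j. Y j \<omega>) (m k) (\<lambda>i. X i \<omega>) - 1" for k \<omega>
  have \<beta>: "0 < \<beta>"
    using assms(8) by linarith
  obtain K where K: "0 \<le> K" "\<forall>\<^sub>F m in sequentially. \<forall>n\<ge>2. (\<integral>w. \<bar>1 / (2 * (real m * real n)) *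
      (\<Sum>i=1..m. \<Sum>j=1..n. XY.gap {1..m} i (m + j) w)\<bar> \<partial>iid P) \<le> K * rate \<beta> m n"
    by (rule XY.integral_mean_gap[OF assms(10-13) \<beta>]) (rule that; assumption)
  \<comment> \<open>The two constants 1/2 add up to the 1 subtracted in \<open>Z\<close>, and the
    two true-depth sums cancel once the order of summation is interchanged.\<close>
  have Z_eq: "Z k = (\<lambda>\<omega>. XY.dev (m k) (n k) \<omega> + YX.dev (n k) (m k) \<omega>)" for k
  proof
    fix \<omega>
    have anti: "sgn (D (Y j \<omega>) P - D (X i \<omega>) P) = - sgn (D (X i \<omega>) P - D (Y j \<omega>) P)" for i j
      using sgn_minus[of "D (X i \<omega>) P - D (Y j \<omega>) P"] by simp
    have "(\<Sum>i=1..m k. \<Sum>j=1..n k. sgn (D (Y j \<omega>) P - D (X i \<omega>) P))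
        = - (\<Sum>j=1..n k. \<Sum>i=1..m k. sgn (D (X i \<omega>) P - D (Y j \<omega>) P))"
      unfolding anti sum_negf by (subst sum.swap) (rule refl)
    then show "Z k \<omega> = XY.dev (m k) (n k) \<omega> + YX.dev (n k) (m k) \<omega>"
      by (simp add: Z_def XY.dev_def YX.dev_def mult.commute)
  qed
  have "big_OP M Z (\<lambda>k. rate \<beta> (m k) (n k))"
  proof (rule M.big_OP_expectation)
    show "Z k \<in> borel_measurable M" for k
      unfolding Z_def using XY.LS_measurable YX.LS_measurable
      by (intro borel_measurable_diff borel_measurable_add borel_measurable_const)
    have large: "\<forall>\<^sub>F k in sequentially. 2 \<le> m k" "\<forall>\<^sub>F k in sequentially. 2 \<le> n k"
      using assms(15,16) by (auto simp: filterlim_at_top)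
    show "\<forall>\<^sub>F k in sequentially. 0 < rate \<beta> (m k) (n k) \<and> integrable M (Z k)
        \<and> M.expectation (\<lambda>\<omega>. \<bar>Z k \<omega>\<bar>) \<le> 2 * K * rate \<beta> (m k) (n k)"
      \<comment> \<open>The estimate for one statistic is used twice: with base size
        \<open>m k\<close> and second size \<open>n k\<close>, and the other way round. The rate is
        symmetric in the two sizes.\<close>
      using eventually_compose_filterlim[OF K(2) assms(15)] eventually_compose_filterlim[OF K(2) assms(16)] large
    proof eventually_elim
      fix k
      assume b1: "\<forall>j\<ge>2. (\<integral>w. \<bar>1 / (2 * (real (m k) * real j)) *
          (\<Sum>i=1..m k. \<Sum>j=1..j. XY.gap {1..m k} i (m k + j) w)\<bar> \<partial>iid P) \<le> K * rate \<beta> (m k) j"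
        and b2: "\<forall>j\<ge>2. (\<integral>w. \<bar>1 / (2 * (real (n k) * real j)) *
          (\<Sum>i=1..n k. \<Sum>j=1..j. XY.gap {1..n k} i (n k + j) w)\<bar> \<partial>iid P) \<le> K * rate \<beta> (n k) j"
        and mn: "2 \<le> m k" "2 \<le> n k"
      have mn1: "1 \<le> m k" "1 \<le> n k"
        using mn by auto
      have "(\<integral>\<omega>. \<bar>XY.dev (m k) (n k) \<omega>\<bar> \<partial>M) \<le> K * rate \<beta> (m k) (n k)"
        unfolding XY.integral_abs_dev[OF mn1] using b1 mn by blast
      moreover have "(\<integral>\<omega>. \<bar>YX.dev (n k) (m k) \<omega>\<bar> \<partial>M) \<le> K * rate \<beta> (n k) (m k)"
        unfolding YX.integral_abs_dev[OF mn1(2,1)] using b2 mn by blast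
      moreover have "rate \<beta> (n k) (m k) = rate \<beta> (m k) (n k)"
        by (simp add: rate_def add.commute mult.commute)
      moreover note int = XY.integrable_dev[OF mn1] YX.integrable_dev[OF mn1(2,1)]
      have "(\<integral>\<omega>. \<bar>Z k \<omega>\<bar> \<partial>M) \<le> (\<integral>\<omega>. \<bar>XY.dev (m k) (n k) \<omega>\<bar> + \<bar>YX.dev (n k) (m k) \<omega>\<bar> \<partial>M)"
        unfolding Z_eq using int by (intro integral_mono) auto
      moreover have "\<dots> = (\<integral>\<omega>. \<bar>XY.dev (m k) (n k) \<omega>\<bar> \<partial>M) + (\<integral>\<omega>. \<bar>YX.dev (n k) (m k) \<omega>\<bar> \<partial>M)"
        using int by simp
      ultimately have "(\<integral>\<omega>. \<bar>Z k \<omega>\<bar> \<partial>M) \<le> 2 * K * rate \<beta> (m k) (n k)"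
        by simp
      moreover have "integrable M (Z k)"
        unfolding Z_eq using int by simp
      ultimately show "0 < rate \<beta> (m k) (n k) \<and> integrable M (Z k)
          \<and> M.expectation (\<lambda>\<omega>. \<bar>Z k \<omega>\<bar>) \<le> 2 * K * rate \<beta> (m k) (n k)"
        using rate_bounds(1)[OF \<beta> mn] by blast
    qed
  qed
  moreover have "(\<lambda>k. rate \<beta> (m k) (n k)) = (\<lambda>k. (real (m k + n k) / real (m k * n k)) powr (3/4))"
    if "\<beta> = 1"
    using that by (simp add: rate_def)
  ultimately show ?thesis
    unfolding Z_def by auto
qed

end
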